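(* Let $\{b_n\}_{n=1}^\infty$ and $\{q_n\}_{n=1}^\infty$ be two sequences of integers with $2\le q_n<b_n$ for all $n\ge1$, and let $\mu$ be the associated Moran measure. Then $$\dim_L\mu=\lim_{N\to+\infty}\ \inf_{\substack{k\ge 0,\ n\ge 1\\ b_{k+1}\cdots b_{k+n}\frac{1}{q_{k+n}}\geq N}}\frac{\log \left(q_{k+1}\cdots q_{k+n}\frac{1}{q_{k+n}}\right)}{\log \left(b_{k+1}\cdots b_{k+n}\frac{1}{q_{k+n}}\right)}.$$ In particular: (i) if $\{b_n\}_{n=1}^{\infty}$ is bounded, then $$\dim_L\mu=\liminf_{n\to+\infty}\ \inf_{k\geq1}\frac{\log (q_kq_{k+1}\cdots q_{k+n})}{\log (b_kb_{k+1}\cdots b_{k+n})};$$ (ii) if $\{b_n\}_{n=1}^{\infty}$ is unbounded and $\liminf_{n\to+\infty} \frac{q_n}{b_n^{1-\epsilon}}=0$ for any $\epsilon\in[0,1)$, then $\dim_L\mu=0$.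
   Context: Given sequences of integers $\{b_n\}_{n\ge1}$, $\{q_n\}_{n\ge1}$ with $2\le q_n<b_n$, put $\mathcal{D}_k=\{0,1,\ldots,q_k-1\}$ for $k\ge1$. The associated Moran measure is the Borel probability measure on $\mathbb{R}$ given by the infinite convolution (weak limit of the finite convolutions) $$\mu=\delta_{b_1^{-1}\mathcal{D}_1}\ast \delta_{(b_1b_2)^{-1}\mathcal{D}_2}\ast\cdots \ast \delta_{(b_1b_2\cdots b_k)^{-1}\mathcal{D}_k}\ast\cdots,$$ where for a finite set $\mathcal{E}\subset\mathbb{R}$, $\delta_{\mathcal{E}}=\frac{1}{\#\mathcal{E}}\sum_{e\in\mathcal{E}}\delta_e$ and $\delta_e$ is the Dirac measure at $e$. The lower dimension $\dim_L\mu$ is the supremum of all $s\ge 0$ for which there exists a constant $C>0$ such that for all $0<r<R<|\mathrm{supp}(\mu)|$ and all $x\in\mathrm{supp}(\mu)$, $\frac{\mu(B(x,R))}{\mu(B(x,r))}\ge C\left(\frac{R}{r}\right)^s$, where $|\mathrm{supp}(\mu)|$ is the diameter of the support of $\mu$ and $B(x,r)$ is the ball of center $x$ and radius $r$. *)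

theory Defs
  imports "HOL-Probability.Probability"
begin

definition unif_dirac :: "real set \<Rightarrow> real measure" where
  "unif_dirac E = distr (measure_pmf (pmf_of_set E)) borel (\<lambda>x. x)"

text \<open>The factor of index \<open>k\<close> (for \<open>k \<ge> 1\<close>) is the uniform measure on
  \<open>(b 1 * \<dots> * b k)\<^sup>-\<^sup>1 * {0, \<dots>, q k - 1}\<close>; values of \<open>b\<close> and \<open>q\<close> at \<open>0\<close> are never used.\<close>

definition moran_factor :: "(nat \<Rightarrow> int) \<Rightarrow> (nat \<Rightarrow> int) \<Rightarrow> nat \<Rightarrow> real measure" where
  "moran_factor b q k =
     unif_dirac ((\<lambda>d. real_of_int d / real_of_int (\<Prod>i=1..k. b i)) ` {0..<q k})"

primrec moran_conv :: "(nat \<Rightarrow> int) \<Rightarrow> (nat \<Rightarrow> int) \<Rightarrow> nat \<Rightarrow> real measure" where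
  "moran_conv b q 0 = return borel 0"
| "moran_conv b q (Suc k) = convolution (moran_conv b q k) (moran_factor b q (Suc k))"

definition is_moran_measure :: "(nat \<Rightarrow> int) \<Rightarrow> (nat \<Rightarrow> int) \<Rightarrow> real measure \<Rightarrow> bool" where
  "is_moran_measure b q \<mu> \<longleftrightarrow> real_distribution \<mu> \<and> weak_conv_m (moran_conv b q) \<mu>"

definition msupport :: "real measure \<Rightarrow> real set" where
  "msupport \<mu> = {x. \<forall>U. open U \<longrightarrow> x \<in> U \<longrightarrow> emeasure \<mu> U > 0}"

text \<open>Intended for Borel probability measures with bounded support: \<^const>\<open>diameter\<close> is
  real-valued and not meaningful on unbounded sets. The supremum is taken in \<^typ>\<open>ereal\<close>, so it
  needs no boundedness side condition.\<close>

definition lower_dim :: "real measure \<Rightarrow> ereal" where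
  "lower_dim \<mu> = (SUP s \<in> {s::real. s \<ge> 0 \<and>
     (\<exists>C>0. \<forall>r R x. 0 < r \<longrightarrow> r < R \<longrightarrow> R < diameter (msupport \<mu>) \<longrightarrow> x \<in> msupport \<mu> \<longrightarrow>
        measure \<mu> (ball x R) / measure \<mu> (ball x r) \<ge> C * (R / r) powr s)}. ereal s)"

end

theory Submission
  imports Defs
begin

text \<open>
  Put \<open>B\<^sub>k = b\<^sub>1 \<dots> b\<^sub>k\<close> and \<open>Q\<^sub>k = q\<^sub>1 \<dots> q\<^sub>k\<close>. The measure is carried by \<open>Q\<^sub>k\<close> cylinders of level \<open>k\<close>,
  each of mass \<open>1 / Q\<^sub>k\<close> and of diameter about \<open>q\<^sub>k\<^sub>+\<^sub>1 / B\<^sub>k\<^sub>+\<^sub>1\<close>, with left end points in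
  \<open>B\<^sub>k\<^sup>-\<^sup>1 \<int>\<close>. Counting cylinders shows, up to constant factors, that a ball of radius
  \<open>r \<in> [1 / B\<^sub>k, 1 / B\<^sub>k\<^sub>-\<^sub>1]\<close> centred in the support has mass \<open>min(q\<^sub>k, r B\<^sub>k) / Q\<^sub>k\<close>.
  As a function of \<open>r\<close> this is alternately linear and constant, so for \<open>s \<le> 1\<close> the ratio of masses,
  compared with \<open>(R / r)\<^sup>s\<close>, is smallest when \<open>R = 1 / B\<^sub>k\<close> and \<open>r = q\<^sub>m\<^sub>+\<^sub>1 / B\<^sub>m\<^sub>+\<^sub>1\<close>. For these
  radii it is \<open>Q\<^sub>m / Q\<^sub>k\<close> against \<open>(B\<^sub>m\<^sub>+\<^sub>1 / (B\<^sub>k q\<^sub>m\<^sub>+\<^sub>1))\<^sup>s\<close>, which is the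
  quotient of logarithms in the formula with \<open>m = k + n - 1\<close>. In case (ii) the terms with \<open>n = 1\<close>
  already force the infimum to be \<open>0\<close>.
\<close>

subsection \<open>Uniform convolution factors, weak limits and supports\<close>

lemma unif_dirac_prob:
  shows "prob_space (unif_dirac E)" "sets (unif_dirac E) = sets borel" "space (unif_dirac E) = UNIV"
  unfolding unif_dirac_def
  by (auto intro!: prob_space.prob_space_distr measure_pmf.prob_space_axioms)

text \<open>Averaging over translates turns the recursion for \<open>moran_conv\<close> into finite
  sums. The two factors are exchanged first, so that the outer integral runs over the finite set
  \<open>E\<close>.\<close>

lemma convolution_unif_dirac:
  fixes M :: "real measure"
  assumes M: "finite_measure M" "sets M = sets borel"
    and E: "finite E" "E \<noteq> {}" and S: "S \<in> sets borel"
  shows "measure (convolution M (unif_dirac E)) S = (\<Sum>e\<in>E. measure M {x. x + e \<in> S}) / card E"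
proof -
  interpret M: finite_measure M by fact
  interpret D: prob_space "unif_dirac E" by (rule unif_dirac_prob)
  have meas: "{x. x + e \<in> S} \<in> sets M" for e
  proof -
    have "(\<lambda>x. x + e) -` S \<inter> space borel \<in> sets borel"
      by (rule measurable_sets[OF _ S]) simp
    then show ?thesis by (simp add: M vimage_def)
  qed
  have fD: "finite_measure (unif_dirac E)" by (rule D.finite_measure_axioms)
  have sp: "space M = UNIV" using sets_eq_imp_space_eq[OF M(2)] by simp
  have mf: "(\<lambda>x. emeasure M {a. x + a \<in> S}) \<in> borel_measurable borel"
  proof -
    have 1: "(\<lambda>(a,x). indicator S (x + a) :: ennreal) \<in> borel_measurable (borel \<Otimes>\<^sub>M M)"
    proof -
      have "(\<lambda>x. indicator S (snd x + fst x) :: ennreal) \<in> borel_measurable (borel \<Otimes>\<^sub>M borel)"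
        by (rule measurable_compose[OF _ borel_measurable_indicator[OF S]]) measurable
      then show ?thesis
        by (subst measurable_cong_sets[OF sets_pair_measure_cong[OF refl M(2)] refl])
          (simp add: case_prod_unfold)
    qed
    have "(\<lambda>x. \<integral>\<^sup>+a. indicator S (a + x) \<partial>M) \<in> borel_measurable borel"
      using M.borel_measurable_nn_integral[OF 1] by simp
    moreover have "(\<integral>\<^sup>+a. indicator S (a + x) \<partial>M) = emeasure M {a. x + a \<in> S}" for x
    proof -
      have "(\<integral>\<^sup>+a. indicator S (a + x) \<partial>M) = (\<integral>\<^sup>+a. indicator {a. x + a \<in> S} a \<partial>M)"
        by (intro nn_integral_cong) (simp add: add.commute indicator_def)
      also have "\<dots> = emeasure M {a. x + a \<in> S}"
        using meas[of x] by (intro nn_integral_indicator) (simp add: add.commute)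
      finally show ?thesis .
    qed
    ultimately show ?thesis by simp
  qed
  have "emeasure (convolution M (unif_dirac E)) S = emeasure (convolution (unif_dirac E) M) S"
    by (subst convolution_commutative) (auto simp: M fD unif_dirac_prob)
  also have "\<dots> = (\<integral>\<^sup>+x. emeasure M {a. x + a \<in> S} \<partial>unif_dirac E)"
    by (subst convolution_emeasure) (auto simp: M fD unif_dirac_prob S sp add.commute)
  also have "\<dots> = (\<integral>\<^sup>+x. emeasure M {a. x + a \<in> S} \<partial>measure_pmf (pmf_of_set E))"
    unfolding unif_dirac_def using mf by (subst nn_integral_distr) auto
  also have "\<dots> = (\<Sum>e\<in>E. emeasure M {a. e + a \<in> S}) / ennreal (card E)"
    using E by (subst nn_integral_pmf_of_set) (auto simp: ennreal_of_nat_eq_real_of_nat)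
  also have "\<dots> = ennreal ((\<Sum>e\<in>E. measure M {x. x + e \<in> S}) / card E)"
    using E by (simp add: M.emeasure_eq_measure sum_ennreal divide_ennreal sum_nonneg card_gt_0_iff add.commute)
  finally show ?thesis
    by (intro measure_eq_emeasure_eq_ennreal) (auto intro!: divide_nonneg_nonneg sum_nonneg)
qed

text \<open>This is the portmanteau bound for closed sets. The indicator of \<open>F\<close> is
  approximated from above by bounded continuous functions \<open>f j\<close>, which are 1 on
  \<open>F\<close> and, for positive \<open>j\<close>, vanish at distance at least
  \<open>1 / j\<close> from it. The approximation uses that \<open>F\<close> is nonempty, because
  \<open>infdist x {}\<close> is 0 by convention and \<open>f j\<close> would be constantly
  1.\<close>

lemma (in real_distribution) weak_conv_closed_ge:
  assumes wc: "weak_conv_m N M" and N: "\<And>n. real_distribution (N n)"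
    and F: "closed F" "F \<noteq> {}" and p: "\<And>n. n \<ge> n0 \<Longrightarrow> p \<le> measure (N n) F"
  shows "p \<le> measure M F"
proof -
  define f where "f j x = max 0 (1 - real j * infdist x F)" for j x
  have cont: "isCont (f j) x" for j x
    unfolding f_def by (intro continuous_intros)
  have meas[measurable]: "f j \<in> borel_measurable borel" for j
    using cont by (intro borel_measurable_continuous_onI) (auto simp: continuous_on_eq_continuous_at)
  have bd: "norm (f j x) \<le> 1" for j x
    unfolding f_def using infdist_nonneg[of x F] by auto
  have Fm: "F \<in> sets borel" using F by simp
  have ge: "p \<le> integral\<^sup>L M (f j)" for j
  proof (rule LIMSEQ_le_const)
    show "(\<lambda>n. integral\<^sup>L (N n) (f j)) \<longlonglongrightarrow> integral\<^sup>L M (f j)"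
      using weak_conv_imp_integral_bdd_continuous_conv[OF N real_distribution_axioms wc cont bd] .
    have "p \<le> integral\<^sup>L (N n) (f j)" if "n \<ge> n0" for n
    proof -
      interpret Nn: real_distribution "N n" by fact
      have "p \<le> measure (N n) F" using p that by simp
      also have "\<dots> = integral\<^sup>L (N n) (indicator F)" using Fm by simp
      also have "\<dots> \<le> integral\<^sup>L (N n) (f j)"
        using Fm bd by (intro integral_mono Nn.integrable_const_bound[of _ 1])
          (auto simp: f_def split: split_indicator)
      finally show ?thesis .
    qed
    then show "\<exists>k. \<forall>n\<ge>k. p \<le> integral\<^sup>L (N n) (f j)" by blast
  qed
  have "(\<lambda>j. integral\<^sup>L M (f j)) \<longlonglongrightarrow> integral\<^sup>L M (indicator F)"
  proof (rule integral_dominated_convergence[where w = "\<lambda>_. 1"])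
    show "AE x in M. (\<lambda>j. f j x) \<longlonglongrightarrow> indicator F x"
    proof (intro AE_I2)
      fix x
      show "(\<lambda>j. f j x) \<longlonglongrightarrow> indicator F x"
      proof (cases "x \<in> F")
        case True
        then show ?thesis by (simp add: f_def)
      next
        case False
        then have pos: "infdist x F > 0"
          using F infdist_nonneg[of x F] in_closed_iff_infdist_zero[of F x] by auto
        obtain j0 :: nat where j0: "1 / infdist x F < real j0" using reals_Archimedean2 by blast
        have "f j x = 0" if "j \<ge> j0" for j
        proof -
          have "1 / infdist x F < real j" using j0 that by simp
          then have "1 < real j * infdist x F" using pos by (simp add: field_simps)
          then show ?thesis by (simp add: f_def)
        qed
        then have "eventually (\<lambda>j. f j x = indicator F x) sequentially"
          using False by (auto simp: eventually_sequentially)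
        then show ?thesis by (rule tendsto_eventually)
      qed
    qed
  qed (use Fm bd in auto)
  then have "p \<le> integral\<^sup>L M (indicator F)"
    using ge by (intro LIMSEQ_le_const) auto
  then show ?thesis using Fm by simp
qed

text \<open>By second countability the complement of the support is a countable union of null basic
  open sets.\<close>

lemma (in real_distribution) measure_msupport: "measure M (- msupport M) = 0"
proof -
  obtain \<B> :: "real set set" where \<B>: "countable \<B>" "topological_basis \<B>"
    using ex_countable_basis by blast
  define \<N> where "\<N> = {U \<in> \<B>. emeasure M U = 0}"
  have eq: "- msupport M = \<Union>\<N>"
  proof (intro set_eqI iffI)
    fix x assume "x \<in> - msupport M"
    then obtain U where U: "open U" "x \<in> U" "emeasure M U = 0"
      by (auto simp: msupport_def)
    obtain V where V: "V \<in> \<B>" "x \<in> V" "V \<subseteq> U"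
      using topological_basisE[OF \<B>(2) U(1,2)] by blast
    have "emeasure M V = 0"
      using emeasure_mono[OF V(3), of M] U by simp
    then show "x \<in> \<Union>\<N>" using V by (auto simp: \<N>_def)
  next
    fix x assume "x \<in> \<Union>\<N>"
    then show "x \<in> - msupport M"
      using topological_basis_open[OF \<B>(2)] by (force simp: \<N>_def msupport_def)
  qed
  have "\<Union>\<N> \<in> null_sets M"
    using \<B> topological_basis_open[OF \<B>(2)]
    by (intro null_sets_UN'[where N = "\<lambda>x. x", simplified]) (auto simp: \<N>_def null_sets_def)
  then show ?thesis by (simp add: eq measure_def null_sets_def)
qed

lemma (in real_distribution) msupport_subset_closed:
  assumes "closed F" "measure M F = 1"
  shows "msupport M \<subseteq> F"
proof
  fix x assume x: "x \<in> msupport M"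
  show "x \<in> F"
  proof (rule ccontr)
    assume "x \<notin> F"
    then have "emeasure M (- F) > 0" using x assms by (auto simp: msupport_def)
    moreover have "measure M (- F) = 0"
      using prob_compl[of F] assms by (simp add: Compl_eq_Diff_UNIV)
    ultimately show False by (simp add: emeasure_eq_measure)
  qed
qed

section \<open>Counting integers in intervals and windows\<close>

lemma card_ints_between:
  fixes x y :: real
  assumes "x \<le> y"
  shows "finite {j::int. x \<le> j \<and> j \<le> y}" "real (card {j::int. x \<le> j \<and> j \<le> y}) \<le> y - x + 1"
proof -
  have eq: "{j::int. x \<le> j \<and> j \<le> y} = {\<lceil>x\<rceil>..\<lfloor>y\<rfloor>}"
    by (auto simp: ceiling_le_iff le_floor_iff)
  show "finite {j::int. x \<le> j \<and> j \<le> y}" unfolding eq by simp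
  show "real (card {j::int. x \<le> j \<and> j \<le> y}) \<le> y - x + 1"
    unfolding eq using assms by simp linarith
qed

text \<open>The worst case is a digit at an end of \<open>{0..<q}\<close>, where only one side of
  the window survives.\<close>

lemma card_int_window:
  fixes d q t :: int
  assumes "0 \<le> d" "d < q" "0 \<le> t"
  shows "min q (t + 1) \<le> int (card {d' \<in> {0..<q}. \<bar>d' - d\<bar> \<le> t})"
proof -
  have "{d' \<in> {0..<q}. \<bar>d' - d\<bar> \<le> t} = {max 0 (d - t)..min (q - 1) (d + t)}" by auto
  then show ?thesis using assms by auto
qed

lemma floor_ge_half:
  fixes u :: real
  assumes "1 \<le> u"
  shows "u / 2 \<le> real_of_int \<lfloor>u\<rfloor>"
proof -
  have "1 \<le> \<lfloor>u\<rfloor>" using assms by simp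
  then have "1 \<le> real_of_int \<lfloor>u\<rfloor>" by linarith
  then show ?thesis by linarith
qed

subsection \<open>The finite convolutions\<close>

locale moran =
  fixes b q :: "nat \<Rightarrow> int"
  assumes digits: "n \<ge> 1 \<Longrightarrow> 2 \<le> q n \<and> q n < b n"
begin

definition B :: "nat \<Rightarrow> real" where "B k = real_of_int (\<Prod>i=1..k. b i)"
definition Q :: "nat \<Rightarrow> real" where "Q k = real_of_int (\<Prod>i=1..k. q i)"

text \<open>The atoms of the \<open>k\<close>-th convolution are the points \<open>j / B k\<close> with \<open>j \<in> numerators k\<close>.\<close>

primrec numerators :: "nat \<Rightarrow> int set" where
  "numerators 0 = {0}"
| "numerators (Suc k) = (\<lambda>(j, d). b (Suc k) * j + d) ` (numerators k \<times> {0..<q (Suc k)})"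

lemma B_0 [simp]: "B 0 = 1" and Q_0 [simp]: "Q 0 = 1"
  by (simp_all add: B_def Q_def)

lemma B_Suc: "B (Suc k) = B k * real_of_int (b (Suc k))"
  and Q_Suc: "Q (Suc k) = Q k * real_of_int (q (Suc k))"
  by (simp_all add: B_def Q_def)

lemma q_ge: "n \<ge> 1 \<Longrightarrow> 2 \<le> q n" and b_ge: "n \<ge> 1 \<Longrightarrow> 3 \<le> b n" and q_less: "n \<ge> 1 \<Longrightarrow> q n < b n"
  and q_ge_real: "n \<ge> 1 \<Longrightarrow> 2 \<le> real_of_int (q n)"
  and b_ge_real: "n \<ge> 1 \<Longrightarrow> 3 \<le> real_of_int (b n)"
  and q_less_real: "n \<ge> 1 \<Longrightarrow> real_of_int (q n) < real_of_int (b n)"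
  using digits[of n] by auto

lemma B_pos [simp]: "B k > 0" and Q_pos [simp]: "Q k > 0"
proof -
  have "0 < b i \<and> 0 < q i" if "i \<in> {1..k}" for i using that b_ge[of i] q_ge[of i] by simp
  then have "0 < (\<Prod>i=1..k. b i)" "0 < (\<Prod>i=1..k. q i)" by (auto intro!: prod_pos)
  then show "B k > 0" "Q k > 0" unfolding B_def Q_def by (simp_all only: of_int_0_less_iff)
qed

lemma B_nz [simp]: "B k \<noteq> 0" and Q_nz [simp]: "Q k \<noteq> 0"
  and B_nn [simp]: "B k \<ge> 0" and Q_nn [simp]: "Q k \<ge> 0"
  using B_pos[of k] Q_pos[of k] by linarith+

text \<open>Digits are smaller than \<open>b (Suc k)\<close>, so Euclidean division recovers
  \<open>(j, d)\<close> from \<open>b (Suc k) * j + d\<close>. Distinct digit strings therefore give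
  distinct atoms, and the counts multiply.\<close>

lemma finite_numerators: "finite (numerators k)"
  and card_numerators: "real (card (numerators k)) = Q k"
proof (induction k)
  case (Suc k)
  {
    case 1
    show ?case using Suc by simp
  next
    case 2
    have "inj_on (\<lambda>(j, d). b (Suc k) * j + d) (numerators k \<times> {0..<q (Suc k)})"
    proof (rule inj_onI, clarify)
      fix j d j' d'
      assume d: "d \<in> {0..<q (Suc k)}" "d' \<in> {0..<q (Suc k)}"
        and eq: "b (Suc k) * j + d = b (Suc k) * j' + d'"
      have lt: "0 \<le> d" "d < b (Suc k)" "0 \<le> d'" "d' < b (Suc k)"
        using d q_less[of "Suc k"] by auto
      have "(b (Suc k) * j + d) div b (Suc k) = j" "(b (Suc k) * j' + d') div b (Suc k) = j'"
        using lt by auto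
      then show "j = j' \<and> d = d'" using eq by auto
    qed
    then show ?case
      using Suc q_ge[of "Suc k"] by (simp add: card_image card_cartesian_product Q_Suc)
  }
qed auto

lemma numerators_ne: "numerators k \<noteq> {}"
  using card_numerators[of k] Q_pos[of k] by (metis card.empty of_nat_0 less_irrefl)

lemma moran_conv_real_distribution: "real_distribution (moran_conv b q k)"
proof (induction k)
  case 0
  have "prob_space (return borel (0::real))" by (rule prob_space_return) simp
  then show ?case by (simp add: real_distribution_def real_distribution_axioms_def)
next
  case (Suc k)
  interpret M: real_distribution "moran_conv b q k" by fact
  have sp: "sets (moran_factor b q (Suc k)) = sets borel"
    by (simp add: moran_factor_def unif_dirac_prob)
  interpret D: prob_space "moran_factor b q (Suc k)"
    unfolding moran_factor_def by (rule unif_dirac_prob)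
  interpret P: pair_prob_space "moran_conv b q k" "moran_factor b q (Suc k)" ..
  have "prob_space (distr (moran_conv b q k \<Otimes>\<^sub>M moran_factor b q (Suc k)) borel (\<lambda>(x, y). x + y))"
    by (rule P.prob_space_distr,
        subst measurable_cong_sets[OF sets_pair_measure_cong[OF M.events_eq_borel sp] refl]) measurable
  then show ?case
    by (simp add: real_distribution_def real_distribution_axioms_def convolution_def)
qed

lemma measure_moran_conv_Suc:
  assumes S: "S \<in> sets borel"
  shows "measure (moran_conv b q (Suc k)) S =
    (\<Sum>d\<in>{0..<q (Suc k)}. measure (moran_conv b q k) {x. x + d / B (Suc k) \<in> S}) / q (Suc k)"
proof -
  interpret M: real_distribution "moran_conv b q k" by (rule moran_conv_real_distribution)
  let ?E = "(\<lambda>d. real_of_int d / B (Suc k)) ` {0..<q (Suc k)}"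
  have inj: "inj_on (\<lambda>d. real_of_int d / B (Suc k)) {0..<q (Suc k)}"
    by (rule inj_onI) simp
  have ne: "?E \<noteq> {}" using q_ge[of "Suc k"] by simp
  have "measure (moran_conv b q (Suc k)) S = measure (convolution (moran_conv b q k) (unif_dirac ?E)) S"
    by (simp add: moran_factor_def B_def)
  also have "\<dots> = (\<Sum>e\<in>?E. measure (moran_conv b q k) {x. x + e \<in> S}) / card ?E"
    by (rule convolution_unif_dirac[OF _ _ _ ne S]) (auto intro: M.finite_measure_axioms)
  also have "\<dots> = (\<Sum>d\<in>{0..<q (Suc k)}. measure (moran_conv b q k) {x. x + d / B (Suc k) \<in> S}) / q (Suc k)"
    using q_ge[of "Suc k"] by (simp add: sum.reindex[OF inj] card_image[OF inj])
  finally show ?thesis .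
qed

lemma translate_borel: "S \<in> sets borel \<Longrightarrow> {x. x + e \<in> S} \<in> sets borel" for e :: real
  using measurable_sets[of "\<lambda>x. x + e" borel borel S] by (simp add: vimage_def)

text \<open>The induction ranges over all Borel sets because the recursion replaces \<open>S\<close>
  by its translates.\<close>

lemma measure_moran_conv:
  "S \<in> sets borel \<Longrightarrow> measure (moran_conv b q k) S = card {j \<in> numerators k. j / B k \<in> S} / Q k"
proof (induction k arbitrary: S)
  case 0
  have "{j. j = (0::int) \<and> real_of_int j \<in> S} = (if 0 \<in> S then {0} else {})" by auto
  then show ?case using 0 by (simp add: measure_return indicator_def)
next
  case (Suc k)
  let ?f = "\<lambda>(j, d). b (Suc k) * j + d"
  let ?A = "\<lambda>d. {j \<in> numerators k. j / B k + d / B (Suc k) \<in> S}"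
  \<comment> \<open>Injectivity is read off from the cardinality already computed in
    \<open>card_numerators\<close>.\<close>
  have inj: "inj_on ?f (numerators k \<times> {0..<q (Suc k)})"
  proof (rule eq_card_imp_inj_on)
    show "finite (numerators k \<times> {0..<q (Suc k)})" using finite_numerators by simp
    have "real (card (numerators (Suc k))) = real (card (numerators k \<times> {0..<q (Suc k)}))"
      using q_ge[of "Suc k"]
      by (simp only: card_numerators) (simp add: card_cartesian_product card_numerators Q_Suc)
    then show "card (?f ` (numerators k \<times> {0..<q (Suc k)})) = card (numerators k \<times> {0..<q (Suc k)})"
      by simp
  qed
  have val: "real_of_int (b (Suc k) * j + d) / B (Suc k) = j / B k + d / B (Suc k)" for j d
    using b_ge[of "Suc k"] by (simp add: B_Suc field_simps)
  have sub: "{(j, d) \<in> numerators k \<times> {0..<q (Suc k)}. j / B k + d / B (Suc k) \<in> S}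
      \<subseteq> numerators k \<times> {0..<q (Suc k)}" by blast
  have eq1: "{j \<in> numerators (Suc k). j / B (Suc k) \<in> S}
      = ?f ` {(j, d) \<in> numerators k \<times> {0..<q (Suc k)}. j / B k + d / B (Suc k) \<in> S}"
  proof (intro set_eqI iffI)
    fix x assume "x \<in> {j \<in> numerators (Suc k). j / B (Suc k) \<in> S}"
    then obtain j d where jd: "x = b (Suc k) * j + d" "j \<in> numerators k" "d \<in> {0..<q (Suc k)}" "x / B (Suc k) \<in> S"
      by auto
    have "j / B k + d / B (Suc k) \<in> S" using jd(4) unfolding jd(1) val .
    with jd show "x \<in> ?f ` {(j, d) \<in> numerators k \<times> {0..<q (Suc k)}. j / B k + d / B (Suc k) \<in> S}"
      by (intro image_eqI[of _ _ "(j, d)"]) simp_all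
  next
    fix x assume "x \<in> ?f ` {(j, d) \<in> numerators k \<times> {0..<q (Suc k)}. j / B k + d / B (Suc k) \<in> S}"
    then obtain j d where jd: "x = b (Suc k) * j + d" "j \<in> numerators k" "d \<in> {0..<q (Suc k)}"
      "j / B k + d / B (Suc k) \<in> S" by auto
    then have "x \<in> numerators (Suc k)"
      unfolding numerators.simps by (intro image_eqI[of _ _ "(j, d)"]) simp_all
    then show "x \<in> {j \<in> numerators (Suc k). j / B (Suc k) \<in> S}"
      using jd(4) unfolding jd(1) mem_Collect_eq val by blast
  qed
  have eq2: "{(j, d) \<in> numerators k \<times> {0..<q (Suc k)}. j / B k + d / B (Suc k) \<in> S}
      = prod.swap ` (SIGMA d:{0..<q (Suc k)}. ?A d)"
    by (auto simp: image_iff)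
  have "card {j \<in> numerators (Suc k). j / B (Suc k) \<in> S}
      = card {(j, d) \<in> numerators k \<times> {0..<q (Suc k)}. j / B k + d / B (Suc k) \<in> S}"
    unfolding eq1 by (rule card_image[OF inj_on_subset[OF inj sub]])
  also have "\<dots> = card (SIGMA d:{0..<q (Suc k)}. ?A d)"
    unfolding eq2 by (rule card_image) simp
  also have "\<dots> = (\<Sum>d\<in>{0..<q (Suc k)}. card (?A d))"
    using finite_numerators by (subst card_SigmaI) auto
  finally have card: "card {j \<in> numerators (Suc k). j / B (Suc k) \<in> S} = (\<Sum>d\<in>{0..<q (Suc k)}. card (?A d))" .
  have "measure (moran_conv b q (Suc k)) S =
      (\<Sum>d\<in>{0..<q (Suc k)}. card (?A d) / Q k) / q (Suc k)"
    unfolding measure_moran_conv_Suc[OF Suc.prems]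
    using Suc.IH[OF translate_borel[OF Suc.prems]] by simp
  then show ?case unfolding card by (simp add: Q_Suc sum_divide_distrib)
qed

text \<open>The bound holds for all translates of an interval, so it survives further convolution.\<close>

lemma moran_conv_interval_le:
  assumes "0 \<le> l" "m \<le> n"
  shows "measure (moran_conv b q n) {a..a + l} \<le> (l * B m + 1) / Q m"
  using assms(2)
proof (induction n arbitrary: a rule: dec_induct)
  case base
  let ?J = "{j::int. a * B m \<le> j \<and> j \<le> (a + l) * B m}"
  have le: "a * B m \<le> (a + l) * B m" using assms by (simp add: mult_right_mono)
  \<comment> \<open>Only the integrality of the numerators enters: an interval of length
    \<open>l * B m\<close> contains at most \<open>l * B m + 1\<close> integers.\<close>
  have "{j \<in> numerators m. j / B m \<in> {a..a + l}} \<subseteq> ?J"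
    by (auto simp: field_simps)
  then have "card {j \<in> numerators m. j / B m \<in> {a..a + l}} \<le> card ?J"
    by (rule card_mono[OF card_ints_between(1)[OF le]])
  also have "real (card ?J) \<le> l * B m + 1"
    using card_ints_between(2)[OF le] by (simp add: algebra_simps)
  finally show ?case
    by (subst measure_moran_conv) (auto intro!: divide_right_mono)
next
  case (step n)
  have tr: "{x. x + e \<in> {a..a + l}} = {a - e..(a - e) + l}" for e by auto
  have "measure (moran_conv b q (Suc n)) {a..a + l} =
     (\<Sum>d\<in>{0..<q (Suc n)}. measure (moran_conv b q n) {a - d / B (Suc n)..(a - d / B (Suc n)) + l}) / q (Suc n)"
    by (subst measure_moran_conv_Suc) (simp_all only: tr borel_closed closed_atLeastAtMost)
  also have "\<dots> \<le> (\<Sum>d\<in>{0..<q (Suc n)}. (l * B m + 1) / Q m) / q (Suc n)"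
    using q_ge[of "Suc n"] by (intro divide_right_mono sum_mono step.IH) auto
  also have "\<dots> = (l * B m + 1) / Q m" using q_ge[of "Suc n"] by simp
  finally show ?case .
qed

text \<open>One more convolution factor moves mass to the right by at most
  \<open>(q (Suc n) - 1) / B (Suc n)\<close>. Lengthening the intervals by that much lets no mass
  escape.\<close>

lemma moran_conv_thicken_Suc:
  assumes G: "finite G" and l: "0 \<le> l" "(q (Suc n) - 1) / B (Suc n) \<le> l' - l"
  shows "measure (moran_conv b q n) (\<Union>g\<in>G. {g..g + l}) \<le>
    measure (moran_conv b q (Suc n)) (\<Union>g\<in>G. {g..g + l'})"
proof -
  interpret M: real_distribution "moran_conv b q n" by (rule moran_conv_real_distribution)
  have S: "(\<Union>g\<in>G. {g..g + u}) \<in> sets borel" for u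
    using G by (intro borel_closed closed_UN) simp_all
  have "measure (moran_conv b q n) (\<Union>g\<in>G. {g..g + l}) =
      (\<Sum>d\<in>{0..<q (Suc n)}. measure (moran_conv b q n) (\<Union>g\<in>G. {g..g + l})) / q (Suc n)"
    using q_ge[of "Suc n"] by simp
  also have "\<dots> \<le> (\<Sum>d\<in>{0..<q (Suc n)}.
      measure (moran_conv b q n) {x. x + d / B (Suc n) \<in> (\<Union>g\<in>G. {g..g + l'})}) / q (Suc n)"
  proof (intro divide_right_mono sum_mono)
    fix d assume d: "d \<in> {0..<q (Suc n)}"
    have "0 \<le> d / B (Suc n)" using d by (intro divide_nonneg_pos) simp_all
    moreover have "d / B (Suc n) \<le> (q (Suc n) - 1) / B (Suc n)"
    proof (rule divide_right_mono)
      have "d \<le> q (Suc n) - 1" using d by simp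
      then show "real_of_int d \<le> real_of_int (q (Suc n) - 1)" by (simp only: of_int_le_iff)
    qed simp
    ultimately have "(\<Union>g\<in>G. {g..g + l}) \<subseteq> {x. x + d / B (Suc n) \<in> (\<Union>g\<in>G. {g..g + l'})}"
    proof (intro subsetI CollectI)
      fix x assume "x \<in> (\<Union>g\<in>G. {g..g + l})"
      then obtain g where "g \<in> G" "g \<le> x" "x \<le> g + l" by auto
      moreover have "g \<le> x + d / B (Suc n)" "x + d / B (Suc n) \<le> g + l'"
        using calculation l(2) \<open>0 \<le> d / B (Suc n)\<close> \<open>d / B (Suc n) \<le> _\<close> by linarith+
      ultimately show "x + d / B (Suc n) \<in> (\<Union>g\<in>G. {g..g + l'})" by (intro UN_I[of g]) auto
    qed
    then show "measure (moran_conv b q n) (\<Union>g\<in>G. {g..g + l}) \<le>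
        measure (moran_conv b q n) {x. x + d / B (Suc n) \<in> (\<Union>g\<in>G. {g..g + l'})}"
      by (rule M.finite_measure_mono) (use translate_borel[OF S] in simp)
  qed (use q_ge[of "Suc n"] in auto)
  also have "\<dots> = measure (moran_conv b q (Suc n)) (\<Union>g\<in>G. {g..g + l'})"
    by (rule measure_moran_conv_Suc[OF S, symmetric])
  finally show ?thesis .
qed

text \<open>A cylinder of level \<open>k\<close> has length \<open>\<Sum>i>k. (q i - 1) / B i\<close>, which \<open>cyl k\<close> bounds from above.\<close>

definition cyl :: "nat \<Rightarrow> real" where "cyl k = q (Suc k) / B (Suc k)"

lemma cyl_pos: "cyl k > 0"
  using q_ge[of "Suc k"] by (simp add: cyl_def)

lemma cyl_less: "cyl k < 1 / B k"
  using q_less[of "Suc k"] b_ge[of "Suc k"] by (simp add: cyl_def B_Suc field_simps)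

lemma moran_conv_cyl_ge:
  assumes G: "finite G" and "k < n"
  shows "measure (moran_conv b q k) G \<le> measure (moran_conv b q n) (\<Union>g\<in>G. {g..g + cyl k})"
proof -
  interpret M: real_distribution "moran_conv b q n" by (rule moran_conv_real_distribution)
  have "Suc k \<le> n" using assms by simp
  \<comment> \<open>The length \<open>cyl k - 1 / B n\<close> makes the induction telescope: the
    shift at step \<open>Suc n\<close> is at most
    \<open>(b (Suc n) - 1) / B (Suc n) = 1 / B n - 1 / B (Suc n)\<close>. At \<open>n = k\<close>
    the length would be negative, hence the start at \<open>Suc k\<close>.\<close>
  then have "measure (moran_conv b q k) G \<le>
      measure (moran_conv b q n) (\<Union>g\<in>G. {g..g + (cyl k - 1 / B n)})"
  proof (induction n rule: dec_induct)
    case base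
    show ?case
      using moran_conv_thicken_Suc[OF G, of 0 k "cyl k - 1 / B (Suc k)"]
      by (simp add: cyl_def diff_divide_distrib)
  next
    case (step n)
    have mono: "1 / B n \<le> 1 / B (Suc k)" using \<open>Suc k \<le> n\<close>
    proof (induction n rule: dec_induct)
      case (step n)
      have "1 / B (Suc n) \<le> 1 / B n"
        using b_ge[of "Suc n"] by (simp add: B_Suc field_simps)
      then show ?case using step by simp
    qed simp
    have "1 / B (Suc k) \<le> cyl k"
      using q_ge[of "Suc k"] by (simp add: cyl_def divide_right_mono)
    then have 1: "0 \<le> cyl k - 1 / B n" using mono by simp
    have "(q (Suc n) - 1) / B (Suc n) \<le> (b (Suc n) - 1) / B (Suc n)"
      using q_less[of "Suc n"] by (intro divide_right_mono) auto
    also have "\<dots> = 1 / B n - 1 / B (Suc n)"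
      using b_ge[of "Suc n"] by (simp add: B_Suc field_simps)
    finally have 2: "(q (Suc n) - 1) / B (Suc n) \<le> (cyl k - 1 / B (Suc n)) - (cyl k - 1 / B n)"
      by simp
    show ?case using step.IH moran_conv_thicken_Suc[OF G 1 2] by linarith
  qed
  also have "\<dots> \<le> measure (moran_conv b q n) (\<Union>g\<in>G. {g..g + cyl k})"
  proof (rule M.finite_measure_mono)
    have "{g..g + (cyl k - 1 / B n)} \<subseteq> {g..g + cyl k}" for g
      by (rule atLeastatMost_subset_iff[THEN iffD2]) simp
    then show "(\<Union>g\<in>G. {g..g + (cyl k - 1 / B n)}) \<subseteq> (\<Union>g\<in>G. {g..g + cyl k})" by blast
    have "closed (\<Union>g\<in>G. {g..g + cyl k})" using G by (intro closed_UN) auto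
    then show "(\<Union>g\<in>G. {g..g + cyl k}) \<in> M.events" by simp
  qed
  finally show ?thesis .
qed

subsection \<open>The limit of infima\<close>

lemma B_mono: "k \<le> m \<Longrightarrow> B k \<le> B m"
proof (induction m rule: dec_induct)
  case (step m)
  have "B m * 1 \<le> B m * real_of_int (b (Suc m))"
    by (intro mult_left_mono) (use b_ge_real[of "Suc m"] in linarith, simp)
  then show ?case using step.IH unfolding B_Suc by linarith
qed simp

lemma Q_mono: "k \<le> m \<Longrightarrow> Q k \<le> Q m"
proof (induction m rule: dec_induct)
  case (step m)
  have "Q m * 1 \<le> Q m * real_of_int (q (Suc m))"
    by (intro mult_left_mono) (use q_ge_real[of "Suc m"] in linarith, simp)
  then show ?case using step.IH unfolding Q_Suc by linarith
qed simp

lemma B_ge_power: "B k * 3 ^ n \<le> B (k + n)"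
proof (induction n)
  case (Suc n)
  have "B k * 3 ^ Suc n \<le> B (k + n) * 3" using Suc by simp
  also have "\<dots> \<le> B (k + n) * b (Suc (k + n))"
    using b_ge_real[of "Suc (k + n)"] by (intro mult_left_mono) simp_all
  finally show ?case by (simp add: B_Suc)
qed simp

lemma ex_inverse_B_le:
  assumes "0 < r"
  shows "\<exists>m. 1 / B m \<le> r"
proof -
  obtain n where n: "1 / r < 3 ^ n" using real_arch_pow[of 3 "1 / r"] by auto
  also have "\<dots> \<le> B n" using B_ge_power[of 0 n] by simp
  finally show ?thesis using assms by (intro exI[of _ n]) (simp add: field_simps)
qed

text \<open>The ratio of the radii \<open>1 / B k\<close> and \<open>cyl m\<close>; it is the argument of the logarithm in the
  denominator of the formula for \<open>m = k + n - 1\<close>.\<close>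

definition scale_ratio :: "nat \<Rightarrow> nat \<Rightarrow> real" where
  "scale_ratio k m = 1 / (B k * cyl m)"

lemma scale_ratio_pos [simp]: "0 < scale_ratio k m"
  using cyl_pos by (simp add: scale_ratio_def)

lemma scale_ratio_nn [simp]: "0 \<le> scale_ratio k m" and scale_ratio_nz [simp]: "scale_ratio k m \<noteq> 0"
  using scale_ratio_pos[of k m] by linarith+

lemma scale_ratio_gt: "B m / B k < scale_ratio k m"
  using cyl_pos[of m] cyl_less[of m] by (simp add: scale_ratio_def field_simps)

lemma scale_ratio_gt_1: "k \<le> m \<Longrightarrow> 1 < scale_ratio k m"
  using scale_ratio_gt[of m k] B_mono[of k m] by (rule_tac order.strict_trans1[of _ "B m / B k"]) simp_all

lemma ln_scale_ratio_pos: "k \<le> m \<Longrightarrow> 0 < ln (scale_ratio k m)"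
  using scale_ratio_gt_1 by simp

lemma Q_ratio_ge_1: "k \<le> m \<Longrightarrow> 1 \<le> Q m / Q k"
  using Q_mono by simp

text \<open>For \<open>k \<le> m\<close> this is the \<open>s\<close> with
  \<open>Q m / Q k = scale_ratio k m powr s\<close>. It is 0 for \<open>k = m\<close>, which is what
  decides case (ii).\<close>

definition scale_exponent :: "nat \<Rightarrow> nat \<Rightarrow> real" where
  "scale_exponent k m = ln (Q m / Q k) / ln (scale_ratio k m)"

lemma scale_exponent_nonneg: "k \<le> m \<Longrightarrow> 0 \<le> scale_exponent k m"
  unfolding scale_exponent_def
  using Q_ratio_ge_1 ln_scale_ratio_pos by (intro divide_nonneg_pos ln_ge_zero) simp_all

lemma Q_le_B: "Q m \<le> B m"
proof (induction m)
  case (Suc m)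
  have "Q m * real_of_int (q (Suc m)) \<le> B m * real_of_int (b (Suc m))"
    using Suc q_less_real[of "Suc m"] q_ge_real[of "Suc m"] by (intro mult_mono) simp_all
  then show ?case by (simp only: Q_Suc B_Suc)
qed simp

lemma scale_exponent_0_le: "scale_exponent 0 m \<le> 1"
proof -
  have "Q m \<le> scale_ratio 0 m" using Q_le_B[of m] scale_ratio_gt[of m 0] by simp
  then show ?thesis
    using ln_scale_ratio_pos[of 0 m] by (simp add: scale_exponent_def divide_le_eq)
qed

lemma ex_scale_ratio_0_ge: "\<exists>m. N \<le> scale_ratio 0 m"
proof -
  obtain n where "N < 3 ^ n" using real_arch_pow[of 3 N] by auto
  also have "\<dots> \<le> B n" using B_ge_power[of 0 n] by simp
  also have "\<dots> < scale_ratio 0 n" using scale_ratio_gt[of n 0] by simp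
  finally show ?thesis by (intro exI[of _ n]) simp
qed

lemma prod_b: "k \<le> m \<Longrightarrow> real_of_int (\<Prod>i=Suc k..m. b i) = B m / B k"
  and prod_q: "k \<le> m \<Longrightarrow> real_of_int (\<Prod>i=Suc k..m. q i) = Q m / Q k"
proof (induction m rule: dec_induct)
  case (step m)
  { case 1 then show ?case using step by (simp add: B_Suc)
  next case 2 then show ?case using step by (simp add: Q_Suc) }
qed simp_all

lemma prod_b_div: "real_of_int (\<Prod>i=k+1..k+n. b i) * (1 / real_of_int (q (k+n))) = scale_ratio k (k + n - 1)"
  if "1 \<le> n"
proof -
  obtain n' where "n = Suc n'" using \<open>1 \<le> n\<close> by (metis Suc_le_D One_nat_def)
  then show ?thesis using prod_b[of k "k + n"] by (simp add: scale_ratio_def cyl_def)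
qed

lemma prod_q_div: "real_of_int (\<Prod>i=k+1..k+n. q i) * (1 / real_of_int (q (k+n))) = Q (k + n - 1) / Q k"
  if "1 \<le> n"
proof -
  obtain n' where "n = Suc n'" using \<open>1 \<le> n\<close> by (metis Suc_le_D One_nat_def)
  then show ?thesis using prod_q[of k "k + n"] q_ge_real[of "Suc (k + n')"] by (simp add: Q_Suc)
qed

section \<open>The infima over pairs of levels and their limit\<close>

definition inf_exponent :: "nat \<Rightarrow> ereal" where
  "inf_exponent N = (INF (k, m) \<in> {(k, m). k \<le> m \<and> real N \<le> scale_ratio k m}. ereal (scale_exponent k m))"

text \<open>The reindexing \<open>m = k + n - 1\<close> maps the pairs with \<open>n \<ge> 1\<close>
  onto those with \<open>k \<le> m\<close>; its inverse is \<open>n = Suc m - k\<close>.\<close>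

lemma inf_exponent_eq:
  "(INF (k, n) \<in> {(k, n). n \<ge> 1 \<and>
        real_of_int (\<Prod>i=k+1..k+n. b i) * (1 / real_of_int (q (k+n))) \<ge> real N}.
      ereal (ln (real_of_int (\<Prod>i=k+1..k+n. q i) * (1 / real_of_int (q (k+n)))) /
             ln (real_of_int (\<Prod>i=k+1..k+n. b i) * (1 / real_of_int (q (k+n)))))) = inf_exponent N"
  (is "(INF (k, n) \<in> ?A. ?f k n) = _")
proof -
  let ?S = "{(k, m). k \<le> m \<and> real N \<le> scale_ratio k m}"
  have A: "?A = {(k, n). n \<ge> 1 \<and> real N \<le> scale_ratio k (k + n - 1)}"
    by (intro Collect_cong) (simp only: split_beta prod_b_div cong: conj_cong)
  have f: "?f k n = ereal (scale_exponent k (k + n - 1))" if "1 \<le> n" for k n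
    unfolding prod_b_div[OF that] prod_q_div[OF that] scale_exponent_def ..
  have "?S = (\<lambda>(k, n). (k, k + n - 1)) ` ?A"
  proof (intro set_eqI iffI)
    fix p assume "p \<in> ?S"
    then obtain k m where p: "p = (k, m)" "k \<le> m" "real N \<le> scale_ratio k m" by blast
    then show "p \<in> (\<lambda>(k, n). (k, k + n - 1)) ` ?A"
      unfolding A by (intro image_eqI[of _ _ "(k, Suc m - k)"]) simp_all
  next
    fix p assume "p \<in> (\<lambda>(k, n). (k, k + n - 1)) ` ?A"
    then obtain k n where "p = (k, k + n - 1)" "1 \<le> n" "real N \<le> scale_ratio k (k + n - 1)"
      unfolding A by (auto simp only: image_iff mem_Collect_eq Bex_def split: prod.splits)
    then show "p \<in> ?S" by simp
  qed
  then have "inf_exponent N = (INF (k, n) \<in> ?A. ereal (scale_exponent k (k + n - 1)))"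
    unfolding inf_exponent_def by (simp add: image_image case_prod_unfold)
  also have "\<dots> = (INF (k, n) \<in> ?A. ?f k n)"
    by (intro INF_cong refl) (use f in force)
  finally show ?thesis ..
qed

lemma inf_exponent_le: "k \<le> m \<Longrightarrow> real N \<le> scale_ratio k m \<Longrightarrow> inf_exponent N \<le> scale_exponent k m"
  unfolding inf_exponent_def by (intro INF_lower2[of "(k, m)"]) simp_all

lemma inf_exponent_ge:
  "(\<And>k m. k \<le> m \<Longrightarrow> real N \<le> scale_ratio k m \<Longrightarrow> y \<le> ereal (scale_exponent k m)) \<Longrightarrow> y \<le> inf_exponent N"
  unfolding inf_exponent_def by (intro INF_greatest) auto

text \<open>Raising the threshold discards pairs, so the infima increase and their limit is a
  supremum. The later arguments work with this supremum.\<close>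

lemma incseq_inf_exponent: "incseq inf_exponent"
proof (intro incseq_SucI inf_exponent_ge inf_exponent_le)
qed simp_all

lemma inf_exponent_LIMSEQ: "inf_exponent \<longlonglongrightarrow> (SUP N. inf_exponent N)"
  by (rule LIMSEQ_SUP[OF incseq_inf_exponent])

lemma inf_exponent_nonneg: "0 \<le> inf_exponent N"
  by (rule inf_exponent_ge) (simp add: scale_exponent_nonneg)

text \<open>The pairs with \<open>k = 0\<close> suffice, and they reach every threshold. The bound
  keeps exponents below the limit in the range \<open>s \<le> 1\<close> that
  \<open>lower_scalingI\<close> requires.\<close>

lemma inf_exponent_le_1: "inf_exponent N \<le> 1"
proof -
  obtain m where "real N \<le> scale_ratio 0 m" using ex_scale_ratio_0_ge by blast
  then have "inf_exponent N \<le> scale_exponent 0 m" by (intro inf_exponent_le) simp_all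
  also have "\<dots> \<le> 1" using scale_exponent_0_le by simp
  finally show ?thesis .
qed

text \<open>Multiplicative constants become an additive \<open>K\<close> after taking logarithms.
  Once the scale ratio is at least \<open>exp (K / e)\<close>, this \<open>K\<close> costs at most
  \<open>e\<close> in the exponent.\<close>

lemma le_SUP_inf_exponentI:
  assumes "\<And>k m. k \<le> m \<Longrightarrow> M0 \<le> scale_ratio k m \<Longrightarrow>
    s * ln (scale_ratio k m) - K \<le> ln (Q m / Q k)"
  shows "ereal s \<le> (SUP N. inf_exponent N)"
proof (rule ereal_le_epsilon2)
  fix e :: real assume e: "0 < e"
  obtain N :: nat where N: "max M0 (exp (K / e)) \<le> real N" using real_arch_simple by blast
  have "ereal (s - e) \<le> inf_exponent N"
  proof (rule inf_exponent_ge)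
    fix k m assume km: "k \<le> m" and M: "real N \<le> scale_ratio k m"
    have "K / e \<le> ln (scale_ratio k m)" using N M by (subst ln_ge_iff) simp_all
    then have "K \<le> e * ln (scale_ratio k m)" using e by (simp add: divide_le_eq mult.commute)
    moreover have "s * ln (scale_ratio k m) - K \<le> ln (Q m / Q k)" using N M km by (intro assms) simp_all
    ultimately have "(s - e) * ln (scale_ratio k m) \<le> ln (Q m / Q k)" by (simp add: algebra_simps)
    then show "ereal (s - e) \<le> ereal (scale_exponent k m)"
      using ln_scale_ratio_pos[OF km] by (simp add: scale_exponent_def pos_le_divide_eq)
  qed
  also have "\<dots> \<le> (SUP N. inf_exponent N)" by (rule SUP_upper) simp
  finally have "ereal (s - e) + ereal e \<le> (SUP N. inf_exponent N) + ereal e" by (rule add_right_mono)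
  then show "ereal s \<le> (SUP N. inf_exponent N) + ereal e" by simp
qed

text \<open>The quotient in (i) arises from \<open>scale_exponent\<close> by adding the logarithm of
  one \<open>q\<close> to numerator and denominator, and bounded \<open>b\<close> makes this a
  bounded change. Since \<open>3 \<le> b n \<le> \<beta>\<close> for \<open>n \<ge> 1\<close>, a
  large scale ratio and a large number of factors imply each other.\<close>

lemma SUP_inf_exponent_bounded:
  assumes bdd: "bdd_above (b ` {1..})"
  shows "(SUP N. inf_exponent N) = liminf (\<lambda>n. INF k \<in> {1..}.
    ereal (ln (real_of_int (\<Prod>i=k..k+n. q i)) / ln (real_of_int (\<Prod>i=k..k+n. b i))))"
    (is "_ = liminf ?G")
proof -
  obtain \<beta> :: int where \<beta>: "\<And>n. n \<ge> 1 \<Longrightarrow> b n \<le> \<beta>"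
    using bdd by (auto simp: bdd_above_def)
  define E where "E = ln (real_of_int \<beta>)"
  have \<beta>3: "3 \<le> real_of_int \<beta>" using \<beta>[of 1] b_ge[of 1] by simp
  have E: "0 < E" unfolding E_def using \<beta>3 by simp
  define t where "t k n = ln (Q (Suc (k + n)) / Q k) / ln (B (Suc (k + n)) / B k)" for k n
  have G: "?G n = (INF k. ereal (t k n))" for n
  proof -
    have "{1..} = range Suc" by (auto simp: image_iff Suc_le_D)
    then have "?G n = (INF k. ereal (ln (real_of_int (\<Prod>i=Suc k..Suc k+n. q i)) / ln (real_of_int (\<Prod>i=Suc k..Suc k+n. b i))))"
      by (simp only: image_image)
    also have "\<dots> = (INF k. ereal (t k n))"
      by (intro INF_cong refl) (simp only: prod_q prod_b t_def add_Suc le_SucI le_add1)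
    finally show ?thesis .
  qed
  \<comment> \<open>With \<open>a \<le> c\<close>, adding \<open>e > 0\<close> to both parts of
    \<open>a / c\<close> does not decrease the fraction; the increase is at most
    \<open>e / c\<close>, hence at most \<open>E / c\<close>.\<close>
  have cmp: "scale_exponent k (k + n) \<le> t k n \<and> t k n \<le> scale_exponent k (k + n) + E / ln (scale_ratio k (k + n))" for k n
  proof -
    define a c e where "a = ln (Q (k + n) / Q k)" and "c = ln (scale_ratio k (k + n))"
      and "e = ln (real_of_int (q (Suc (k + n))))"
    have q2: "2 \<le> real_of_int (q (Suc (k + n)))" by (rule q_ge_real) simp
    have e: "0 < e" using q2 by (simp add: e_def)
    have "e \<le> E" unfolding e_def E_def
      using q2 q_less_real[of "Suc (k + n)"] \<beta>[of "Suc (k + n)"] by (subst ln_le_cancel_iff) simp_all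
    have c: "0 < c" by (simp add: c_def ln_scale_ratio_pos scale_ratio_gt_1)
    have a0: "0 \<le> a" unfolding a_def using Q_ratio_ge_1[of k "k + n"] by (intro ln_ge_zero) simp_all
    have num: "ln (Q (Suc (k + n)) / Q k) = a + e"
    proof -
      have "Q (Suc (k + n)) / Q k = Q (k + n) / Q k * q (Suc (k + n))" by (simp add: Q_Suc)
      then show ?thesis unfolding a_def e_def
        using q2 Q_pos[of "k + n"] Q_pos[of k] by (simp only:) (intro ln_mult_pos, simp_all)
    qed
    have den: "ln (B (Suc (k + n)) / B k) = c + e"
    proof -
      have "B (Suc (k + n)) / B k = scale_ratio k (k + n) * q (Suc (k + n))"
        using q2 by (simp add: scale_ratio_def cyl_def)
      then show ?thesis unfolding c_def e_def
        using q2 by (simp only:) (intro ln_mult_pos, simp_all)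
    qed
    have "a + e \<le> c + e"
    proof -
      have *: "Q m / Q k \<le> B m / B k" if "k \<le> m" for m
        using that
      proof (induction m rule: dec_induct)
        case (step m)
        have "Q m / Q k * real_of_int (q (Suc m)) \<le> B m / B k * real_of_int (b (Suc m))"
          using step.IH q_less_real[of "Suc m"] q_ge_real[of "Suc m"]
          by (intro mult_mono) (simp_all add: less_imp_le)
        then show ?case by (simp add: Q_Suc B_Suc)
      qed simp
      have "a \<le> c" unfolding a_def c_def
        using *[of "k + n"] scale_ratio_gt[of "k + n" k] by (subst ln_le_cancel_iff) simp_all
      then show ?thesis by simp
    qed
    then have "a * e \<le> c * e" using e by (intro mult_right_mono) simp_all
    then have 1: "a / c \<le> (a + e) / (c + e)" using c e by (simp add: field_simps)
    have "(a + e) / (c + e) \<le> (a + e) / c" using c e a0 by (intro divide_left_mono) simp_all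
    also have "\<dots> \<le> a / c + E / c"
      using c \<open>e \<le> E\<close> by (simp add: add_divide_distrib divide_right_mono)
    finally show ?thesis using 1 unfolding t_def num den scale_exponent_def a_def c_def by simp
  qed
  show ?thesis
  proof (rule antisym)
    show "(SUP N. inf_exponent N) \<le> liminf ?G"
    proof (rule SUP_least)
      fix N
      \<comment> \<open>As every \<open>b\<close> is at least 3,
        \<open>scale_ratio k (k + n)\<close> exceeds \<open>3 ^ n\<close>, so
        \<open>n \<ge> n0\<close> puts the pair above the threshold \<open>N\<close> for every
        \<open>k\<close>.\<close>
      obtain n0 where n0: "real N < 3 ^ n0" using real_arch_pow[of 3 "real N"] by auto
      have "inf_exponent N \<le> ?G n" if n: "n0 \<le> n" for n
        unfolding G
      proof (rule INF_greatest)
        fix k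
        have "real N \<le> 3 ^ n" using n0 power_increasing[OF n, of "3::real"] by linarith
        also have "\<dots> \<le> B (k + n) / B k" using B_ge_power[of k n] by (simp add: le_divide_eq mult.commute)
        also have "\<dots> \<le> scale_ratio k (k + n)" using scale_ratio_gt by (rule less_imp_le)
        finally have "inf_exponent N \<le> scale_exponent k (k + n)" by (intro inf_exponent_le) simp_all
        also have "\<dots> \<le> t k n" using cmp by simp
        finally show "inf_exponent N \<le> ereal (t k n)" .
      qed
      then show "inf_exponent N \<le> liminf ?G"
        by (intro Liminf_bounded) (auto simp: eventually_sequentially)
    qed
  next
    show "liminf ?G \<le> (SUP N. inf_exponent N)"
    proof (rule ccontr)
      assume "\<not> liminf ?G \<le> (SUP N. inf_exponent N)"
      then have "(SUP N. inf_exponent N) < liminf ?G" by (simp only: not_le)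
      from ereal_dense2[OF this] obtain s where s: "(SUP N. inf_exponent N) < ereal s" "ereal s < liminf ?G"
        by blast
      obtain n0 where n0: "\<And>n. n0 \<le> n \<Longrightarrow> ereal s < ?G n"
        using less_LiminfD[OF s(2)] by (auto simp: eventually_sequentially)
      have "ereal s \<le> (SUP N. inf_exponent N)"
      \<comment> \<open>Conversely \<open>scale_ratio k (k + n)\<close> is below
        \<open>\<beta> ^ Suc n\<close>, so a ratio of at least \<open>\<beta> ^ Suc n0\<close>
        forces \<open>n \<ge> n0\<close>.\<close>
      proof (rule le_SUP_inf_exponentI[where K = E and ?M0.0 = "real_of_int \<beta> ^ Suc n0"])
        fix k m assume km: "k \<le> m" and M: "real_of_int \<beta> ^ Suc n0 \<le> scale_ratio k m"
        define n where "n = m - k"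
        have m: "m = k + n" using km by (simp add: n_def)
        have Bp: "B (k + j) \<le> B k * real_of_int \<beta> ^ j" for j
        proof (induction j)
          case (Suc j)
          have "B (k + j) * real_of_int (b (Suc (k + j))) \<le> (B k * real_of_int \<beta> ^ j) * real_of_int \<beta>"
            using Suc \<beta>[of "Suc (k + j)"] \<beta>3 b_ge_real[of "Suc (k + j)"] by (intro mult_mono) simp_all
          then show ?case by (simp add: B_Suc mult_ac)
        qed simp
        have "scale_ratio k m = B (k + Suc n) / B k / q (Suc m)"
          by (simp add: scale_ratio_def cyl_def m)
        also have "\<dots> < B (k + Suc n) / B k"
          using q_ge_real[of "Suc m"] B_pos[of "k + Suc n"] B_pos[of k]
          by (subst divide_less_eq_1_pos[symmetric]) simp_all
        also have "\<dots> \<le> real_of_int \<beta> ^ Suc n" using Bp[of "Suc n"] by (simp add: divide_le_eq mult.commute)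
        finally have "real_of_int \<beta> ^ Suc n0 < real_of_int \<beta> ^ Suc n" using M by simp
        then have "n0 \<le> n" using \<beta>3 by (subst (asm) power_strict_increasing_iff) simp_all
        then have "ereal s < (INF k. ereal (t k n))" using n0 G by simp
        also have "\<dots> \<le> ereal (t k n)" by (rule INF_lower) simp
        also have "\<dots> \<le> ereal (scale_exponent k m + E / ln (scale_ratio k m))" using cmp m by simp
        finally have "s \<le> (ln (Q m / Q k) + E) / ln (scale_ratio k m)"
          by (simp add: scale_exponent_def add_divide_distrib)
        then show "s * ln (scale_ratio k m) - E \<le> ln (Q m / Q k)"
          using ln_scale_ratio_pos[OF km] by (simp add: pos_le_divide_eq)
      qed
      then show False using s(1) by simp
    qed
  qed
qed

text \<open>The pairs \<open>(k, k)\<close> have exponent 0, and their scale ratio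
  \<open>b (Suc k) / q (Suc k)\<close> passes every threshold for some \<open>k\<close>. Comparing
  with \<open>1 / real (Suc N)\<close> avoids division by zero at \<open>N = 0\<close>.\<close>

lemma SUP_inf_exponent_eq_0:
  assumes "liminf (\<lambda>n. ereal (real_of_int (q n) / real_of_int (b n))) = 0"
  shows "(SUP N. inf_exponent N) = 0"
proof -
  have "inf_exponent N = 0" for N
  proof (rule antisym)
    show "inf_exponent N \<le> 0"
    proof -
      have "\<exists>\<^sub>F n in sequentially. real_of_int (q n) / real_of_int (b n) < 1 / real (Suc N)"
      proof (rule ccontr)
        assume "\<not> ?thesis"
        then have "\<forall>\<^sub>F n in sequentially. ereal (1 / real (Suc N)) \<le> ereal (real_of_int (q n) / real_of_int (b n))"
          by (simp only: not_frequently not_less ereal_less_eq)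
        from Liminf_bounded[OF this] show False
          unfolding assms by (simp add: zero_ereal_def)
      qed
      then obtain n where n: "1 \<le> n" "real_of_int (q n) / real_of_int (b n) < 1 / real (Suc N)"
        unfolding frequently_sequentially by blast
      then obtain k where k: "n = Suc k" by (cases n) auto
      have "scale_ratio k k = b n / q n" by (simp add: scale_ratio_def cyl_def k B_Suc)
      also have "real (Suc N) < \<dots>"
        using n q_ge_real[of n] b_ge_real[of n] by (simp add: field_simps)
      finally have "inf_exponent N \<le> scale_exponent k k" by (intro inf_exponent_le) simp_all
      also have "\<dots> = 0" by (simp add: scale_exponent_def)
      finally show ?thesis .
    qed
  qed (rule inf_exponent_nonneg)
  then show ?thesis by simp
qed

end

subsection \<open>Masses of balls and the lower dimension\<close>

locale moran_limit = moran +
  fixes \<mu> :: "real measure"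
  assumes moran_measure: "is_moran_measure b q \<mu>"
begin

sublocale real_distribution \<mu>
  using moran_measure by (simp add: is_moran_measure_def)

lemma limit_closed_ge:
  assumes "closed F" "F \<noteq> {}" "\<And>n. n \<ge> start \<Longrightarrow> p \<le> measure (moran_conv b q n) F"
  shows "p \<le> measure \<mu> F"
  using moran_measure assms
  by (intro weak_conv_closed_ge[of "moran_conv b q" F start] moran_conv_real_distribution)
    (auto simp: is_moran_measure_def)

text \<open>The complement of an open ball is closed, so an upper bound for the ball passes to the
  weak limit as a lower bound for the complement.\<close>

lemma measure_ball_le:
  assumes "0 \<le> r"
  shows "measure \<mu> (ball x r) \<le> (2 * r * B m + 1) / Q m"
proof -
  have compl: "- ball x r = UNIV - ball x r" by auto
  have "1 - (2 * r * B m + 1) / Q m \<le> measure \<mu> (- ball x r)"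
  proof (rule limit_closed_ge[where start = m])
    have "x + r \<in> - ball x r" by (simp add: dist_real_def)
    then show "- ball x r \<noteq> {}" by blast
    fix n assume n: "m \<le> n"
    interpret N: real_distribution "moran_conv b q n" by (rule moran_conv_real_distribution)
    have "N.prob (ball x r) \<le> N.prob {x - r..(x - r) + 2 * r}"
      by (rule N.finite_measure_mono) (auto simp: ball_eq_greaterThanLessThan)
    also have "\<dots> \<le> (2 * r * B m + 1) / Q m"
      using assms n by (intro moran_conv_interval_le) simp_all
    finally show "1 - (2 * r * B m + 1) / Q m \<le> N.prob (- ball x r)"
      using N.prob_compl[of "ball x r"] by (simp add: compl)
  qed (simp add: closed_def)
  then show ?thesis using prob_compl[of "ball x r"] by (simp add: compl)
qed

lemma closed_cylinders: "finite G \<Longrightarrow> closed (\<Union>g\<in>G. {g..g + cyl k})"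
  by (intro closed_UN) simp_all

lemma measure_cylinders_ge:
  assumes "finite G" "G \<noteq> {}"
  shows "measure (moran_conv b q k) G \<le> measure \<mu> (\<Union>g\<in>G. {g..g + cyl k})"
proof (rule limit_closed_ge[where start = "Suc k"])
  show "(\<Union>g\<in>G. {g..g + cyl k}) \<noteq> {}" using assms cyl_pos[of k] by simp
  show "measure (moran_conv b q k) G \<le> measure (moran_conv b q n) (\<Union>g\<in>G. {g..g + cyl k})"
    if "Suc k \<le> n" for n
    using that assms by (intro moran_conv_cyl_ge) simp_all
qed (rule closed_cylinders[OF assms(1)])

text \<open>The cylinders of level \<open>k\<close> form a closed set of full measure, which
  therefore contains the support.\<close>

lemma msupport_cylinderE:
  assumes "x \<in> msupport \<mu>"
  obtains j where "j \<in> numerators k" "j / B k \<le> x" "x \<le> j / B k + cyl k"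
proof -
  let ?G = "(\<lambda>j. real_of_int j / B k) ` numerators k"
  let ?F = "\<Union>g\<in>?G. {g..g + cyl k}"
  have G: "finite ?G" "?G \<noteq> {}" using finite_numerators numerators_ne by simp_all
  have "{j \<in> numerators k. real_of_int j / B k \<in> ?G} = numerators k" by blast
  moreover have "?G \<in> sets borel" using G by (simp add: borel_closed finite_imp_closed)
  ultimately have "measure (moran_conv b q k) ?G = 1"
    by (subst measure_moran_conv) (simp_all add: card_numerators)
  then have "measure \<mu> ?F = 1"
    using measure_cylinders_ge[OF G, of k] by (intro antisym prob_le_1) simp
  then have "msupport \<mu> \<subseteq> ?F"
    by (rule msupport_subset_closed[OF closed_cylinders[OF G(1)]])
  then show ?thesis using assms that by auto
qed

text \<open>The ball contains every cylinder of level \<open>k\<close> that has the same first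
  \<open>k - 1\<close> digits as one around \<open>x\<close> and a last digit within
  \<open>t\<close> of its last digit. Each contributes mass \<open>1 / Q k\<close>, and
  \<open>card_int_window\<close> counts them.\<close>

lemma measure_ball_ge:
  assumes x: "x \<in> msupport \<mu>" and k: "1 \<le> k" and R: "1 / B k \<le> R"
  shows "min (q k) (R * B k / 2) / Q k \<le> measure \<mu> (ball x R)"
proof -
  obtain k' where k': "k = Suc k'" using k by (cases k) auto
  obtain j where j: "j \<in> numerators k" "j / B k \<le> x" "x \<le> j / B k + cyl k"
    using msupport_cylinderE[OF x] .
  obtain j' d where d: "j = b k * j' + d" "j' \<in> numerators k'" "d \<in> {0..<q k}"
    using j(1) unfolding k' numerators.simps by (auto simp only: image_iff mem_Sigma_iff Bex_def split: prod.splits)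
  have RB: "1 \<le> R * B k" using R by (simp add: divide_le_eq)
  \<comment> \<open>The subtracted 1 reserves room for the length of one cylinder, which is less
    than \<open>1 / B k\<close>.\<close>
  define t where "t = \<lfloor>R * B k\<rfloor> - 1"
  have t: "0 \<le> t" using RB by (simp add: t_def)
  define W where "W = {d' \<in> {0..<q k}. \<bar>d' - d\<bar> \<le> t}"
  define f where "f d' = b k * j' + d'" for d'
  let ?G = "(\<lambda>d'. real_of_int (f d') / B k) ` W"
  let ?F = "\<Union>g\<in>?G. {g..g + cyl k}"
  have fW: "finite W" unfolding W_def by (rule finite_subset[of _ "{0..<q k}"]) auto
  have "d \<in> W" using d(3) t by (simp add: W_def)
  with fW have G: "finite ?G" "?G \<noteq> {}" by auto
  have "min (q k) (t + 1) \<le> int (card W)"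
    unfolding W_def using d(3) t by (intro card_int_window) simp_all
  then have "min (real_of_int (q k)) (real_of_int (t + 1)) \<le> real (card W)"
    by linarith
  moreover have "R * B k / 2 \<le> real_of_int (t + 1)"
    using floor_ge_half[OF RB] by (simp add: t_def)
  ultimately have cW: "min (real_of_int (q k)) (R * B k / 2) \<le> real (card W)"
    by linarith
  have "f ` W \<subseteq> {j \<in> numerators k. j / B k \<in> ?G}"
  proof
    fix i assume "i \<in> f ` W"
    then obtain d' where d': "d' \<in> W" "i = f d'" by blast
    have "(\<lambda>(j, d). b (Suc k') * j + d) (j', d') \<in> numerators k"
      unfolding k' numerators.simps using d' d(2)
      by (intro imageI) (simp add: W_def k')
    then have "i \<in> numerators k" by (simp add: d' f_def k')
    then show "i \<in> {j \<in> numerators k. j / B k \<in> ?G}" using d' by blast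
  qed
  moreover have "finite {j \<in> numerators k. j / B k \<in> ?G}" using finite_numerators by simp
  moreover have "card (f ` W) = card W" by (rule card_image) (simp add: inj_on_def f_def)
  ultimately have "card W \<le> card {j \<in> numerators k. j / B k \<in> ?G}"
    using card_mono by metis
  then have "real (card W) / Q k \<le> measure (moran_conv b q k) ?G"
    using G(1) by (subst measure_moran_conv) (auto simp: borel_closed finite_imp_closed intro!: divide_right_mono)
  also have "\<dots> \<le> measure \<mu> ?F" by (rule measure_cylinders_ge[OF G])
  also have "\<dots> \<le> measure \<mu> (ball x R)"
  proof (rule finite_measure_mono)
    show "?F \<subseteq> ball x R"
    proof
      fix y assume "y \<in> ?F"
      then obtain d' where d': "d' \<in> W" "f d' / B k \<le> y" "y \<le> f d' / B k + cyl k" by auto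
      have "f d' - j = d' - d" by (simp add: f_def d)
      then have *: "f d' / B k - j / B k = (d' - d) / B k"
        by (simp flip: diff_divide_distrib of_int_diff)
      have "\<bar>real_of_int (d' - d)\<bar> \<le> t" using d'(1) by (simp only: W_def mem_Collect_eq of_int_abs[symmetric] of_int_le_iff)
      then have "\<bar>(d' - d) / B k\<bar> \<le> t / B k"
        by (simp add: divide_right_mono)
      then have "\<bar>x - y\<bar> \<le> t / B k + cyl k" using * d' j by linarith
      also have "\<dots> < t / B k + 1 / B k" using cyl_less by simp
      also have "\<dots> \<le> R"
      proof -
        have "real_of_int t + 1 \<le> R * B k" by (simp add: t_def)
        then have "(real_of_int t + 1) / B k \<le> R" by (simp add: divide_le_eq)
        then show ?thesis by (simp add: add_divide_distrib)
      qed
      finally show "y \<in> ball x R" by (simp add: dist_real_def)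
    qed
  qed simp
  finally show ?thesis using cW divide_right_mono[OF cW, of "Q k"] by simp
qed

lemma measure_ball_pos:
  assumes "x \<in> msupport \<mu>" "0 < r"
  shows "0 < measure \<mu> (ball x r)"
proof -
  have "0 < emeasure \<mu> (ball x r)" using assms by (simp add: msupport_def)
  then show ?thesis by (simp add: emeasure_eq_measure)
qed

lemma msupport_subset: "msupport \<mu> \<subseteq> {0..1}"
proof
  fix x assume "x \<in> msupport \<mu>"
  then obtain j where "j \<in> numerators 0" "j / B 0 \<le> x" "x \<le> j / B 0 + cyl 0"
    by (rule msupport_cylinderE)
  then show "x \<in> {0..1}" using cyl_less[of 0] by simp
qed

lemma diameter_msupport_le: "diameter (msupport \<mu>) \<le> 1"
proof (rule diameter_le)
  fix x y assume "x \<in> msupport \<mu>" "y \<in> msupport \<mu>"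
  then have "x \<in> {0..1}" "y \<in> {0..1}" using msupport_subset by blast+
  then show "norm (x - y) \<le> 1" by (auto simp: real_norm_def)
qed simp

text \<open>With diameter 0 the condition in \<open>lower_dim\<close> would be vacuous. Level 2 is
  used because \<open>3 / Q 2\<close> is at most 3/4, so no ball of radius \<open>1 / B 2\<close>
  carries all the mass; at level 1 the bound \<open>3 / Q 1\<close> may exceed 1.\<close>

lemma diameter_msupport_pos: "0 < diameter (msupport \<mu>)"
proof -
  have ms: "msupport \<mu> \<in> sets borel"
  proof -
    have "open (- msupport \<mu>)"
    proof (subst open_subopen, intro ballI)
      fix x assume "x \<in> - msupport \<mu>"
      then obtain U where "open U" "x \<in> U" "\<not> 0 < emeasure \<mu> U" by (auto simp: msupport_def)
      then show "\<exists>T. open T \<and> x \<in> T \<and> T \<subseteq> - msupport \<mu>"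
        by (intro exI[of _ U]) (auto simp: msupport_def)
    qed
    then show ?thesis by (simp add: borel_closed closed_def)
  qed
  have full: "measure \<mu> (msupport \<mu>) = 1"
    using prob_compl[of "msupport \<mu>"] measure_msupport ms by (simp add: Compl_eq_Diff_UNIV)
  have small: "measure \<mu> (ball x (1 / B 2)) < 1" for x
  proof -
    have "measure \<mu> (ball x (1 / B 2)) \<le> (2 * (1 / B 2) * B 2 + 1) / Q 2"
      by (rule measure_ball_le) simp
    also have "\<dots> = 3 / Q 2" by simp
    also have "Q 2 = q 1 * q 2"
      using Q_Suc[of 0] Q_Suc[of 1] by (simp add: numeral_2_eq_2)
    also have "3 / real_of_int (q 1 * q 2) < 1"
    proof -
      have "2 * 2 \<le> q 1 * q 2" using q_ge[of 1] q_ge[of 2] by (intro mult_mono) simp_all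
      then have "4 \<le> real_of_int (q 1 * q 2)" by linarith
      then show ?thesis by (simp add: divide_less_eq)
    qed
    finally show ?thesis .
  qed
  have "msupport \<mu> \<noteq> {}" using full by auto
  then obtain x where x: "x \<in> msupport \<mu>" by blast
  have "\<not> msupport \<mu> \<subseteq> ball x (1 / B 2)"
    using finite_measure_mono[of "msupport \<mu>" "ball x (1 / B 2)"] small[of x] full by auto
  then obtain y where y: "y \<in> msupport \<mu>" "y \<notin> ball x (1 / B 2)" by blast
  have "bounded (msupport \<mu>)" using msupport_subset bounded_subset bounded_closed_interval by blast
  then have "dist x y \<le> diameter (msupport \<mu>)" using x y by (intro diameter_bounded_bound)
  moreover have "0 < 1 / B 2" by simp
  moreover have "1 / B 2 \<le> dist x y" using y(2) by (simp only: mem_ball not_less)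
  ultimately show ?thesis by linarith
qed

text \<open>Levels \<open>m\<close> and \<open>Suc m\<close> give the bounds \<open>3 / Q m\<close>
  and \<open>3 * ?u / Q m\<close>. For \<open>0 \<le> s \<le> 1\<close> the smaller of 1 and
  \<open>?u\<close> is at most \<open>?u powr s\<close>, which merges the two.\<close>

lemma measure_ball_le_powr:
  assumes r: "0 < r" "1 / B (Suc m) \<le> r" "r * B m < 1" and s: "0 \<le> s" "s \<le> 1"
  shows "measure \<mu> (ball x r) \<le> 3 * (r / cyl m) powr s / Q m"
proof -
  let ?u = "r / cyl m"
  have u: "0 < ?u" using r cyl_pos by simp
  have "measure \<mu> (ball x r) \<le> (2 * r * B m + 1) / Q m"
    using r by (intro measure_ball_le) simp
  also have "\<dots> \<le> 3 / Q m" using r by (intro divide_right_mono) simp_all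
  finally have 1: "measure \<mu> (ball x r) \<le> 3 / Q m" .
  have "1 \<le> r * B (Suc m)" using r by (simp add: divide_le_eq)
  then have "(2 * r * B (Suc m) + 1) / Q (Suc m) \<le> 3 * r * B (Suc m) / Q (Suc m)"
    by (intro divide_right_mono) simp_all
  also have "\<dots> = 3 * ?u / Q m"
    using q_ge_real[of "Suc m"] by (simp add: cyl_def Q_Suc field_simps)
  finally have 2: "measure \<mu> (ball x r) \<le> 3 * ?u / Q m"
    using measure_ball_le[of r x "Suc m"] r by simp
  show ?thesis
  proof (cases "?u \<le> 1")
    case True
    then have "?u \<le> ?u powr s" using powr_mono'[of s 1 ?u] u s by (simp only: powr_one less_imp_le)
    then have "3 * ?u / Q m \<le> 3 * ?u powr s / Q m" by (intro divide_right_mono) simp_all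
    then show ?thesis using 2 by linarith
  next
    case False
    then have "1 \<le> ?u powr s" using s by (intro ge_one_powr_ge_zero) simp_all
    then have "3 / Q m \<le> 3 * ?u powr s / Q m" by (intro divide_right_mono) simp_all
    then show ?thesis using 1 by linarith
  qed
qed

text \<open>The two outcomes are the linear and the constant regime of the minimum in
  \<open>measure_ball_ge\<close>. The constant one gives away a factor 2 so that both have the same
  denominator pattern.\<close>

lemma measure_ball_ge_cases:
  assumes x: "x \<in> msupport \<mu>" and R: "1 / B (Suc k) \<le> R"
  obtains "R * B (Suc k) / (2 * Q (Suc k)) \<le> measure \<mu> (ball x R)"
  | "1 / (2 * Q k) \<le> measure \<mu> (ball x R)"
proof (cases "R * B (Suc k) / 2 \<le> q (Suc k)")
  case True
  then have "min (real_of_int (q (Suc k))) (R * B (Suc k) / 2) = R * B (Suc k) / 2" by (rule min_absorb2)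
  then show ?thesis using measure_ball_ge[OF x _ R] that(1) by simp
next
  case False
  have "1 / (2 * Q k) \<le> q (Suc k) / Q (Suc k)"
    using q_ge_real[of "Suc k"] by (simp add: Q_Suc field_simps)
  moreover have "min (real_of_int (q (Suc k))) (R * B (Suc k) / 2) = q (Suc k)"
    using False by (intro min_absorb1) simp
  ultimately show ?thesis using measure_ball_ge[OF x _ R] that(2) by simp
qed

section \<open>The scaling condition and the critical radii\<close>

definition lower_scaling :: "real \<Rightarrow> real \<Rightarrow> bool" where
  "lower_scaling s C \<longleftrightarrow> (\<forall>r R x. 0 < r \<longrightarrow> r < R \<longrightarrow> R < diameter (msupport \<mu>) \<longrightarrow> x \<in> msupport \<mu> \<longrightarrow>
     measure \<mu> (ball x R) / measure \<mu> (ball x r) \<ge> C * (R / r) powr s)"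

lemma lower_dim_eq: "lower_dim \<mu> = (SUP s \<in> {s. 0 \<le> s \<and> (\<exists>C>0. lower_scaling s C)}. ereal s)"
  unfolding lower_dim_def lower_scaling_def by simp

text \<open>The condition is tested at the critical radii, where the masses are at most
  \<open>3 / Q k\<close> and at least \<open>1 / (2 * Q m)\<close>. Since \<open>lower_dim\<close>
  admits only radii below the diameter, the larger one is shrunk by a fixed factor
  \<open>c\<close>.\<close>

lemma lower_scalingD:
  assumes sc: "lower_scaling s C" and C: "0 < C"
  shows "\<exists>M0 K. \<forall>k m. k \<le> m \<longrightarrow> M0 \<le> scale_ratio k m \<longrightarrow>
    s * ln (scale_ratio k m) - K \<le> ln (Q m / Q k)"
proof -
  obtain x where x: "x \<in> msupport \<mu>"
    using diameter_msupport_pos by (cases "msupport \<mu> = {}") auto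
  define c where "c = min 1 (diameter (msupport \<mu>) / 2)"
  have c: "0 < c" "c \<le> 1" "c < diameter (msupport \<mu>)"
    using diameter_msupport_pos by (auto simp: c_def)
  \<comment> \<open>The logarithms of all constants are collected here, with 6 = 3 * 2 from the two
    mass bounds. The threshold \<open>2 / c\<close> below ensures \<open>R / r \<ge> 2\<close>,
    hence \<open>r < R\<close>.\<close>
  define K where "K = ln 6 - ln C - s * ln c"
  show ?thesis
  proof (rule exI[of _ "2 / c"], rule exI[of _ K], intro allI impI)
    fix k m assume km: "k \<le> m" and M: "2 / c \<le> scale_ratio k m"
    let ?M = "scale_ratio k m"
    define R r where "R = c / B k" and "r = cyl m"
    have r: "0 < r" using cyl_pos by (simp add: r_def)
    have Rr: "R / r = c * ?M" by (simp add: R_def r_def scale_ratio_def)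
    have "2 \<le> c * ?M" using M c by (simp add: divide_le_eq mult.commute)
    then have rR: "r < R" using r Rr by (simp add: divide_eq_eq)
    have "1 \<le> B k" using B_mono[of 0 k] by simp
    then have "R \<le> c" using c by (simp add: R_def divide_le_eq mult_le_cancel_left1)
    then have RD: "R < diameter (msupport \<mu>)" using c by simp
    have up: "measure \<mu> (ball x R) \<le> 3 / Q k"
    proof -
      have "measure \<mu> (ball x R) \<le> (2 * R * B k + 1) / Q k"
        using r rR by (intro measure_ball_le) simp
      also have "\<dots> \<le> 3 / Q k" using c by (intro divide_right_mono) (simp_all add: R_def)
      finally show ?thesis .
    qed
    have lo: "1 / (2 * Q m) \<le> measure \<mu> (ball x r)"
    proof -
      have "1 / B (Suc m) \<le> r"
        using q_ge_real[of "Suc m"] by (simp add: r_def cyl_def divide_right_mono)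
      moreover have "r * B (Suc m) = q (Suc m)" by (simp add: r_def cyl_def)
      ultimately have "min (q (Suc m)) (q (Suc m) / 2) / Q (Suc m) \<le> measure \<mu> (ball x r)"
        using measure_ball_ge[OF x, of "Suc m" r] by simp
      moreover have "min (real_of_int (q (Suc m))) (q (Suc m) / 2) / Q (Suc m) = 1 / (2 * Q m)"
        using q_ge_real[of "Suc m"] by (simp add: min_def Q_Suc)
      ultimately show ?thesis by simp
    qed
    have "C * (c * ?M) powr s \<le> measure \<mu> (ball x R) / measure \<mu> (ball x r)"
      using sc r rR RD x unfolding lower_scaling_def Rr[symmetric] by blast
    also have "\<dots> \<le> (3 / Q k) / (1 / (2 * Q m))"
      using up lo by (intro frac_le) simp_all
    also have "\<dots> = 6 * (Q m / Q k)" by simp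
    finally have "ln (C * (c * ?M) powr s) \<le> ln (6 * (Q m / Q k))"
      using C c scale_ratio_pos[of k m] Q_pos[of k] Q_pos[of m] by (subst ln_le_cancel_iff) auto
    moreover have "ln (C * (c * ?M) powr s) = ln C + s * (ln c + ln ?M)"
      using C c by (simp add: ln_mult ln_powr)
    moreover have "ln (6 * (Q m / Q k)) = ln 6 + ln (Q m / Q k)"
      using Q_pos[of k] Q_pos[of m] by (intro ln_mult_pos) simp_all
    ultimately show "s * ln ?M - K \<le> ln (Q m / Q k)" by (simp add: K_def algebra_simps)
  qed
qed

text \<open>In the constant, \<open>N powr (- s)\<close> pays for pairs whose scale ratio is below
  \<open>N\<close>, and 6 = 2 * 3 comes from the lower and upper mass bounds.\<close>

lemma lower_scalingI:
  assumes N: "1 \<le> N" and s: "0 \<le> s" "s \<le> 1"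
    and le: "\<And>k m. k \<le> m \<Longrightarrow> N \<le> scale_ratio k m \<Longrightarrow> s * ln (scale_ratio k m) \<le> ln (Q m / Q k)"
  shows "lower_scaling s (N powr (- s) / 6)"
proof -
  define c where "c = N powr (- s)"
  have c: "0 < c" "c \<le> 1" using N s by (auto simp: c_def powr_minus field_simps ge_one_powr_ge_zero)
  \<comment> \<open>The factor \<open>c\<close> removes the threshold: below \<open>N\<close> the
    left side is at most 1, while \<open>Q m / Q k\<close> is at least 1.\<close>
  have key: "c * scale_ratio k m powr s \<le> Q m / Q k" if km: "k \<le> m" for k m
  proof (cases "N \<le> scale_ratio k m")
    case True
    have "scale_ratio k m powr s = exp (s * ln (scale_ratio k m))"
      using scale_ratio_pos[of k m] by (simp add: powr_def)
    also have "\<dots> \<le> Q m / Q k" using le[OF km True] by (subst ln_ge_iff[symmetric]) simp_all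
    finally have "1 * scale_ratio k m powr s \<le> Q m / Q k" by simp
    moreover have "c * scale_ratio k m powr s \<le> 1 * scale_ratio k m powr s"
      using c by (intro mult_right_mono) simp_all
    ultimately show ?thesis by linarith
  next
    case False
    then have "c * scale_ratio k m powr s \<le> c * N powr s"
      using c s scale_ratio_pos[of k m] by (intro mult_left_mono powr_mono2) simp_all
    also have "\<dots> = 1" using N by (simp add: c_def flip: powr_add)
    finally show ?thesis using Q_ratio_ge_1[OF km] by linarith
  qed
  show ?thesis unfolding lower_scaling_def c_def[symmetric]
  proof (intro allI impI)
    fix r R x
    assume r: "0 < r" and rR: "r < R" and RD: "R < diameter (msupport \<mu>)" and x: "x \<in> msupport \<mu>"
    have R: "0 < R" "R < 1" using r rR RD diameter_msupport_le by simp_all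
    \<comment> \<open>This locates a radius between consecutive values of \<open>1 / B\<close>. The
      least index is positive because \<open>\<rho> < 1 = 1 / B 0\<close>.\<close>
    have ex: "\<exists>k. 1 / B (Suc k) \<le> \<rho> \<and> \<rho> * B k < 1" if \<rho>: "0 < \<rho>" "\<rho> < 1" for \<rho>
    proof -
      define n where "n = (LEAST m. 1 / B m \<le> \<rho>)"
      have n: "1 / B n \<le> \<rho>" unfolding n_def using ex_inverse_B_le[OF \<rho>(1)] by (rule LeastI_ex)
      then obtain k where k: "n = Suc k" using \<rho> by (cases n) auto
      have "\<not> 1 / B k \<le> \<rho>" using not_less_Least[of k "\<lambda>m. 1 / B m \<le> \<rho>"] k by (simp add: n_def)
      then show ?thesis using n k by (intro exI[of _ k]) (simp add: field_simps)
    qed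
    obtain k where k: "1 / B (Suc k) \<le> R" "R * B k < 1" using ex[OF R] by blast
    obtain m where m: "1 / B (Suc m) \<le> r" "r * B m < 1" using ex[of r] r rR R by auto
    have km: "k \<le> m"
    proof (rule ccontr)
      assume "\<not> k \<le> m"
      then have "B (Suc m) \<le> B k" by (intro B_mono) simp
      then have "R * B (Suc m) < 1" using k(2) R mult_left_mono[of "B (Suc m)" "B k" R] by linarith
      moreover have "1 \<le> r * B (Suc m)" using m(1) by (simp add: divide_le_eq)
      moreover have "r * B (Suc m) \<le> R * B (Suc m)" using rR by (intro mult_right_mono) simp_all
      ultimately show False by simp
    qed
    have pos: "0 < measure \<mu> (ball x r)" by (rule measure_ball_pos[OF x r])
    have Rr: "1 \<le> R / r" using r rR by simp
    \<comment> \<open>\<open>R / r\<close> factors into the critical ratio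
      \<open>scale_ratio k' m\<close> and two corrections, \<open>R * B k'\<close> and
      \<open>r / cyl m\<close>. The first is absorbed by \<open>lo\<close>, the second by
      \<open>measure_ball_le_powr\<close>. The level \<open>k'\<close> will be \<open>Suc k\<close>
      in the linear regime and \<open>k\<close> in the constant one.\<close>
    have bridge: "c / 6 * (R / r) powr s \<le> measure \<mu> (ball x R) / measure \<mu> (ball x r)"
      if k'm: "k' \<le> m" and lo: "(R * B k') powr s / (2 * Q k') \<le> measure \<mu> (ball x R)" for k'
    proof -
      have eq: "R / r = (R * B k') * scale_ratio k' m / (r / cyl m)"
        using cyl_pos[of m] by (simp add: scale_ratio_def)
      have "(R / r) powr s = (R * B k') powr s * scale_ratio k' m powr s / (r / cyl m) powr s"
        unfolding eq using R r scale_ratio_pos[of k' m] cyl_pos[of m] B_pos[of k']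
        by (subst powr_divide) (simp_all add: powr_mult)
      then have "c / 6 * (R / r) powr s =
          (c * scale_ratio k' m powr s) * ((R * B k') powr s / (6 * (r / cyl m) powr s))"
        by simp
      also have "\<dots> \<le> (Q m / Q k') * ((R * B k') powr s / (6 * (r / cyl m) powr s))"
        using key[OF k'm] by (intro mult_right_mono) simp_all
      also have "\<dots> = ((R * B k') powr s / (2 * Q k')) / (3 * (r / cyl m) powr s / Q m)"
        by (simp add: mult_ac)
      also have "\<dots> \<le> measure \<mu> (ball x R) / measure \<mu> (ball x r)"
        using lo measure_ball_le_powr[OF r m s, of x] pos by (intro frac_le) simp_all
      finally show ?thesis .
    qed
    from x k(1) show "c / 6 * (R / r) powr s \<le> measure \<mu> (ball x R) / measure \<mu> (ball x r)"
    proof (cases rule: measure_ball_ge_cases)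
      case 1
      show ?thesis
      \<comment> \<open>For \<open>k = m\<close> the level \<open>Suc k\<close> exceeds
        \<open>m\<close> and \<open>bridge\<close> does not apply. Both radii then lie on the same
        scale, so linear bounds for both masses give a ratio of at least
        \<open>(R / r) / 6\<close>.\<close>
      proof (cases "k = m")
        case False
        have "1 \<le> R * B (Suc k)" using k(1) by (simp add: divide_le_eq)
        then have "(R * B (Suc k)) powr s \<le> R * B (Suc k)"
          using powr_mono[of s 1 "R * B (Suc k)"] s by simp
        then have "(R * B (Suc k)) powr s / (2 * Q (Suc k)) \<le> R * B (Suc k) / (2 * Q (Suc k))"
          by (intro divide_right_mono) simp_all
        then show ?thesis using 1 km False by (intro bridge[of "Suc k"]) simp_all
      next
        case True
        have "1 \<le> r * B (Suc m)" using m(1) by (simp add: divide_le_eq)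
        then have "(2 * r * B (Suc m) + 1) / Q (Suc m) \<le> 3 * r * B (Suc m) / Q (Suc m)"
          by (intro divide_right_mono) simp_all
        then have up: "measure \<mu> (ball x r) \<le> 3 * r * B (Suc m) / Q (Suc m)"
          using measure_ball_le[of r x "Suc m"] r by simp
        have "(R / r) powr s \<le> R / r" using powr_mono[of s 1 "R / r"] Rr s by simp
        moreover have "c / 6 * (R / r) powr s \<le> 1 / 6 * (R / r) powr s"
          using c by (intro mult_right_mono) simp_all
        ultimately have "c / 6 * (R / r) powr s \<le> 1 / 6 * (R / r)" by linarith
        also have "\<dots> = (R * B (Suc m) / (2 * Q (Suc m))) / (3 * r * B (Suc m) / Q (Suc m))"
          by (simp add: mult_ac)
        also have "\<dots> \<le> measure \<mu> (ball x R) / measure \<mu> (ball x r)"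
          using 1 up pos True by (intro frac_le) simp_all
        finally show ?thesis .
      qed
    next
      case 2
      \<comment> \<open>In the constant regime \<open>R * B k < 1\<close>, so the power in
        \<open>lo\<close> can only shrink the bound.\<close>
      have "(R * B k) powr s \<le> 1" using k(2) R s by (intro powr_le1) simp_all
      then have "(R * B k) powr s / (2 * Q k) \<le> 1 / (2 * Q k)" by (intro divide_right_mono) simp_all
      then show ?thesis using 2 km by (intro bridge[of k]) simp_all
    qed
  qed
qed

lemma lower_dim_eq_SUP: "lower_dim \<mu> = (SUP N. inf_exponent N)"
proof (rule antisym)
  show "lower_dim \<mu> \<le> (SUP N. inf_exponent N)"
    unfolding lower_dim_eq
  proof (rule SUP_least, clarify)
    fix s C :: real assume "0 < C" "lower_scaling s C"
    obtain M0 where "\<exists>K. \<forall>k m. k \<le> m \<longrightarrow> M0 \<le> scale_ratio k m \<longrightarrow>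
        s * ln (scale_ratio k m) - K \<le> ln (Q m / Q k)"
      using lower_scalingD[OF \<open>lower_scaling s C\<close> \<open>0 < C\<close>] ..
    then obtain K where *: "\<forall>k m. k \<le> m \<longrightarrow> M0 \<le> scale_ratio k m \<longrightarrow>
        s * ln (scale_ratio k m) - K \<le> ln (Q m / Q k)"
      ..
    show "ereal s \<le> (SUP N. inf_exponent N)"
      by (rule le_SUP_inf_exponentI) (rule *[rule_format])
  qed
next
  have upper: "ereal s \<le> lower_dim \<mu>"
    if "1 \<le> N" "0 \<le> s" "s \<le> 1" "\<And>k m. k \<le> m \<Longrightarrow> N \<le> scale_ratio k m \<Longrightarrow> s * ln (scale_ratio k m) \<le> ln (Q m / Q k)" for s N
  proof -
    have "lower_scaling s (N powr (- s) / 6)" using that by (rule lower_scalingI)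
    moreover have "0 < N powr (- s) / 6" using that by simp
    ultimately show ?thesis unfolding lower_dim_eq using that(2) by (intro SUP_upper) blast
  qed
  show "(SUP N. inf_exponent N) \<le> lower_dim \<mu>"
  proof (rule SUP_least, rule ccontr)
    fix N assume "\<not> inf_exponent N \<le> lower_dim \<mu>"
    then have "lower_dim \<mu> < inf_exponent N" by (simp only: not_le)
    from ereal_dense2[OF this] obtain s where s: "lower_dim \<mu> < ereal s" "ereal s < inf_exponent N"
      by blast
    \<comment> \<open>The exponent 0 is always admissible. This makes the intermediate
      \<open>s\<close> positive, as \<open>upper\<close> demands \<open>0 \<le> s\<close>.\<close>
    have "ereal 0 \<le> lower_dim \<mu>"
      using Q_ratio_ge_1 by (intro upper[of 1]) simp_all
    then have "ereal 0 < ereal s" using s(1) by (rule le_less_trans)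
    moreover have "ereal s < 1" using s(2) inf_exponent_le_1 by (rule less_le_trans)
    moreover have "s * ln (scale_ratio k m) \<le> ln (Q m / Q k)"
      if "k \<le> m" "max 1 (real N) \<le> scale_ratio k m" for k m
    proof -
      have "ereal s \<le> ereal (scale_exponent k m)"
        using that by (intro order.trans[OF less_imp_le[OF s(2)]] inf_exponent_le) simp_all
      then show ?thesis
        using ln_scale_ratio_pos[OF that(1)] by (simp add: scale_exponent_def pos_le_divide_eq)
    qed
    ultimately have "ereal s \<le> lower_dim \<mu>" by (intro upper[of "max 1 (real N)"]) simp_all
    then show False using s(1) by simp
  qed
qed

end

theorem proposition1p4:
  fixes b q :: "nat \<Rightarrow> int" and \<mu> :: "real measure"
  assumes "\<And>n. n \<ge> 1 \<Longrightarrow> 2 \<le> q n \<and> q n < b n"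
    and "is_moran_measure b q \<mu>"
  shows "((\<lambda>N::nat. INF (k, n) \<in> {(k, n). n \<ge> 1 \<and>
              real_of_int (\<Prod>i=k+1..k+n. b i) * (1 / real_of_int (q (k+n))) \<ge> real N}.
            ereal (ln (real_of_int (\<Prod>i=k+1..k+n. q i) * (1 / real_of_int (q (k+n)))) /
                   ln (real_of_int (\<Prod>i=k+1..k+n. b i) * (1 / real_of_int (q (k+n))))))
          \<longlonglongrightarrow> lower_dim \<mu>) \<and>
         (bdd_above (b ` {1..}) \<longrightarrow>
            lower_dim \<mu> = liminf (\<lambda>n. INF k \<in> {1..}.
              ereal (ln (real_of_int (\<Prod>i=k..k+n. q i)) / ln (real_of_int (\<Prod>i=k..k+n. b i))))) \<and>
         (\<not> bdd_above (b ` {1..}) \<and>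
            (\<forall>\<epsilon>::real. 0 \<le> \<epsilon> \<and> \<epsilon> < 1 \<longrightarrow>
               liminf (\<lambda>n. ereal (real_of_int (q n) / real_of_int (b n) powr (1 - \<epsilon>))) = 0) \<longrightarrow>
            lower_dim \<mu> = 0)"
proof -
  interpret moran_limit b q \<mu> using assms by unfold_locales auto
  have "lower_dim \<mu> = 0"
    if "\<forall>\<epsilon>::real. 0 \<le> \<epsilon> \<and> \<epsilon> < 1 \<longrightarrow>
      liminf (\<lambda>n. ereal (real_of_int (q n) / real_of_int (b n) powr (1 - \<epsilon>))) = 0"
  proof -
    have "liminf (\<lambda>n. ereal (real_of_int (q n) / real_of_int (b n) powr 1)) = 0"
      using that[rule_format, of 0] by simp
    also have "liminf (\<lambda>n. ereal (real_of_int (q n) / real_of_int (b n) powr 1)) =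
        liminf (\<lambda>n. ereal (real_of_int (q n) / real_of_int (b n)))"
    \<comment> \<open>Removing \<open>powr 1\<close> uses that \<open>b n\<close> is nonnegative,
      which is known from index 1 on; \<open>b 0\<close> is arbitrary.\<close>
    proof (rule Liminf_eq)
      have "real_of_int (b n) powr 1 = real_of_int (b n)" if "1 \<le> n" for n
        using b_ge_real[OF that] by simp
      then show "\<forall>\<^sub>F n in sequentially. ereal (real_of_int (q n) / real_of_int (b n) powr 1) =
          ereal (real_of_int (q n) / real_of_int (b n))"
        unfolding eventually_sequentially by (intro exI[of _ 1]) simp
    qed
    finally show ?thesis
      unfolding lower_dim_eq_SUP by (rule SUP_inf_exponent_eq_0)
  qed
  then show ?thesis
    unfolding inf_exponent_eq
    using inf_exponent_LIMSEQ SUP_inf_exponent_bounded lower_dim_eq_SUP by auto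
qed

end
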